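(* Let $u\in\mathbb R^d$ and let $M_1,\ldots,M_d\in{\rm Her}_r(\mathbb C)$ satisfy $\sum_iu_iM_i=I_r$. Assume that $C=\mathcal S_1(M_1,\ldots,M_d)\subseteq\mathbb R^d$ is a salient polyhedral cone. Then the following are equivalent: (1) For all $t\ge1$ and all $N_1,\ldots,N_d\in{\rm Her}_t(\mathbb C)$ with $\sum_iu_iN_i=I_t$: if $\mathcal S_1(M_1,\ldots,M_d)\subseteq\mathcal S_1(N_1,\ldots,N_d)$, then there exist finitely many matrices $V_j\in\mathbb M_{r,t}(\mathbb C)$ such that $\sum_jV_j^*M_iV_j=N_i$ for all $i=1,\ldots,d$. (2) $C$ is a simplex cone.
   Context: ${\rm Her}_r(\mathbb C)$ denotes the Hermitian $r\times r$ matrices, $\mathbb M_{r,t}(\mathbb C)$ the complex $r\times t$ matrices, $\geqslant0$ positive semidefiniteness. For $M_1,\ldots,M_d\in{\rm Her}_r(\mathbb C)$, $\mathcal S_1(M_1,\ldots,M_d):=\{a\in\mathbb R^d\mid a_1M_1+\cdots+a_dM_d\geqslant0\}$. A convex cone $C$ is salient if $C\cap(-C)=\{0\}$. A cone in $\mathbb R^d$ with nonempty interior is a simplex (cone) if it is generated by $d$ linearly independent vectors, i.e. linearly isomorphic to $\mathbb R^d_{\ge0}$. *)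

theory Defs
  imports
    "HOL-Analysis.Analysis"
    "Jordan_Normal_Form.Schur_Decomposition"
begin

text \<open>
  Points of $\mathbb{R}^d$ have type \<^typ>\<open>real ^ 'd\<close>, with \<open>'d\<close> as the index set of the
  matrices \<open>M\<^sub>1, \<dots>, M\<^sub>d\<close>. The matrices have their size in a carrier set, because the
  theorem quantifies over the size \<open>t\<close> inside one of its two conditions. The symbol \<open>$\<close> is
  left to \<^const>\<open>vec_index\<close>.
\<close>

unbundle no vec_syntax

notation vec_nth (infixl \<open>$h\<close> 90)

definition Her :: "nat \<Rightarrow> complex mat set" where
  "Her n = {A \<in> carrier_mat n n. mat_adjoint A = A}"

text \<open>\<open>(A *\<^sub>v v) \<bullet>c v\<close> is \<open>v\<^sup>* A v\<close>; in the order on \<^typ>\<open>complex\<close>, \<open>0 \<le> z\<close> says that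
  \<open>z\<close> is real and nonnegative.\<close>

definition psd :: "nat \<Rightarrow> complex mat \<Rightarrow> bool" where
  "psd n A \<longleftrightarrow> A \<in> Her n \<and> (\<forall>v \<in> carrier_vec n. 0 \<le> (A *\<^sub>v v) \<bullet>c v)"

text \<open>The type \<^typ>\<open>complex mat\<close> has no zero element common to all sizes, so \<^const>\<open>sum\<close>
  does not apply to it; the empty sum here is the zero matrix of the given size.\<close>

definition mat_sum :: "nat \<Rightarrow> nat \<Rightarrow> ('i \<Rightarrow> complex mat) \<Rightarrow> 'i set \<Rightarrow> complex mat" where
  "mat_sum m n A I = mat m n (\<lambda>pq. \<Sum>i\<in>I. A i $$ pq)"

definition mat_lincomb :: "nat \<Rightarrow> real ^ 'd \<Rightarrow> ('d::finite \<Rightarrow> complex mat) \<Rightarrow> complex mat" where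
  "mat_lincomb n a M = mat_sum n n (\<lambda>i. complex_of_real (a $h i) \<cdot>\<^sub>m M i) UNIV"

definition S1 :: "nat \<Rightarrow> ('d::finite \<Rightarrow> complex mat) \<Rightarrow> (real ^ 'd) set" where
  "S1 n M = {a. psd n (mat_lincomb n a M)}"

definition polyhedral_cone :: "'a::euclidean_space set \<Rightarrow> bool" where
  "polyhedral_cone C \<longleftrightarrow> polyhedron C \<and> convex_cone C"

definition salient :: "'a::real_vector set \<Rightarrow> bool" where
  "salient C \<longleftrightarrow> C \<inter> uminus ` C = {0}"

text \<open>A cone generated by a basis has nonempty interior, so this need not be asked for separately.\<close>

definition simplex_cone :: "'a::euclidean_space set \<Rightarrow> bool" where
  "simplex_cone C \<longleftrightarrow>
    (\<exists>B. independent B \<and> card B = DIM('a) \<and> C = convex_cone hull B)"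

end

theory Submission
  imports Defs "HOL-Library.Function_Algebras"
begin

text \<open>
  Let \<open>C = S\<^sub>1(M)\<close>, and write \<open>M(a)\<close> for \<open>\<Sum>\<^sub>i a\<^sub>i M\<^sub>i\<close>.

  Suppose every inclusion is witnessed by matrices \<open>V\<^sub>j\<close>. Let \<open>p, q\<close> be functionals nonnegative
  on \<open>C\<close>, let \<open>H\<close> and \<open>K\<close> be the faces of \<open>C\<close> on which they vanish, and let \<open>x\<close> be a functional
  vanishing on \<open>H \<inter> K\<close>. With a functional \<open>\<sigma>\<close> that is positive on \<open>C - {0}\<close> and a large constant
  \<open>c\<close>, the symmetric pencil of size 2 with diagonal \<open>p + \<epsilon>\<^sup>2 c \<sigma>\<close>, \<open>q + \<epsilon>\<^sup>2 c \<sigma>\<close> and off-diagonal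
  entry \<open>\<epsilon> x\<close> is positive on \<open>C\<close> for all \<open>\<epsilon> > 0\<close>, so it is a compression of \<open>M\<close>.
  For \<open>a\<close> in \<open>span H \<inter> span K\<close> there are \<open>h \<in> H\<close>, \<open>k \<in> K\<close> such that
  \<open>\<bar>v\<^sup>* M(a) w\<bar> \<le> v\<^sup>* M(h) v + w\<^sup>* M(k) w\<close> for all \<open>v, w\<close>; hence \<open>\<epsilon> \<bar>x(a)\<bar> = O(\<epsilon>\<^sup>2)\<close> and \<open>x(a) = 0\<close>.
  So \<open>span H \<inter> span K = span (H \<inter> K)\<close>. As the facets of \<open>C\<close> span hyperplanes, every intersection
  of facets spans the intersection of their hyperplanes; for linearly independent facet
  normals \<open>g\<^sub>1, \<dots>, g\<^sub>d\<close> this gives points of \<open>C\<close> forming the dual basis, which generate \<open>C\<close>.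

  Conversely, if \<open>C\<close> is generated by a basis \<open>B\<close>, then for \<open>b \<in> B\<close> the matrix \<open>M(\<Sum>(B - {b}))\<close> is
  singular, and a kernel vector \<open>v\<close> makes \<open>v\<^sup>* M(a) v\<close> a positive multiple of the \<open>b\<close>-coordinate
  of \<open>a\<close>. Writing each \<open>N(b) \<ge> 0\<close> as a sum of matrices \<open>w w\<^sup>*\<close>, the \<open>V\<^sub>j\<close> are multiples of \<open>v w\<^sup>*\<close>.
\<close>

no_notation scalar_prod (infix "\<bullet>" 70)

section \<open>Polyhedral cones\<close>

lemma convex_cone_sum:
  assumes "convex_cone C" "\<And>i. i \<in> I \<Longrightarrow> 0 \<le> c i" "\<And>i. i \<in> I \<Longrightarrow> b i \<in> C"
  shows "(\<Sum>i\<in>I. c i *\<^sub>R b i) \<in> C"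
  using assms
  by (induction I rule: infinite_finite_induct)
     (auto intro: convex_cone_add convex_cone_scaleR convex_cone_contains_0)

text \<open>Scaling inside the cone turns every defining inequality into a homogeneous one. A system
  with the fewest normals is irredundant: dropping \<open>g\<close> enlarges the set, and a new
  point violates \<open>g\<close> alone.\<close>

lemma polyhedral_cone_irredundant:
  fixes C :: "'a::euclidean_space set"
  assumes "polyhedral_cone C"
  obtains G where "finite G" "C = {x. \<forall>g\<in>G. 0 \<le> g \<bullet> x}"
    "\<forall>g\<in>G. \<exists>z. g \<bullet> z < 0 \<and> (\<forall>h\<in>G - {g}. 0 \<le> h \<bullet> z)"
proof -
  define P where "P G \<longleftrightarrow> finite G \<and> C = {x. \<forall>g\<in>G. 0 \<le> g \<bullet> x}" for G
  have cone: "convex_cone C" using assms by (simp add: polyhedral_cone_def)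
  obtain F where F: "finite F" "C = \<Inter>F" "\<forall>h\<in>F. \<exists>a b. h = {x. a \<bullet> x \<le> b}"
    using assms unfolding polyhedral_cone_def polyhedron_def by metis
  obtain a b where ab: "\<And>h. h \<in> F \<Longrightarrow> h = {x. a h \<bullet> x \<le> b h}"
    using F(3) by metis
  have b: "0 \<le> b h" if "h \<in> F" for h
  proof -
    have "0 \<in> h" using F(2) convex_cone_contains_0[OF cone] that by auto
    then show ?thesis using ab[OF that] by (metis inner_zero_right mem_Collect_eq)
  qed
  have le: "a h \<bullet> x \<le> 0" if "h \<in> F" "x \<in> C" for h x
  proof (rule ccontr)
    assume "\<not> a h \<bullet> x \<le> 0"
    then have pos: "0 < a h \<bullet> x" by simp
    \<comment> \<open>The factor is chosen so that \<open>a h\<close> takes the value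
      \<open>b h + 1\<close> at the scaled point, which violates the inequality of
      \<open>h\<close>.\<close>
    have "((b h + 1) / (a h \<bullet> x)) *\<^sub>R x \<in> C"
      using convex_cone_scaleR[OF cone _ that(2)] pos b[OF that(1)] by simp
    then have "((b h + 1) / (a h \<bullet> x)) *\<^sub>R x \<in> {x. a h \<bullet> x \<le> b h}"
      using F(2) that(1) ab by blast
    then show False using pos by simp
  qed
  have "P ((\<lambda>h. - a h) ` F)"
    unfolding P_def
  proof (intro conjI)
    show "C = {x. \<forall>g\<in>(\<lambda>h. - a h) ` F. 0 \<le> g \<bullet> x}"
    proof (intro subset_antisym subsetI)
      fix x assume "x \<in> {x. \<forall>g\<in>(\<lambda>h. - a h) ` F. 0 \<le> g \<bullet> x}"
      then have "a h \<bullet> x \<le> b h" if "h \<in> F" for h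
        using b[OF that] that by fastforce
      then have "x \<in> h" if "h \<in> F" for h
        using ab[OF that] that by blast
      then show "x \<in> C" using F(2) by blast
    qed (use le in auto)
  qed (use F(1) in simp)
  then obtain G where G: "P G" "\<forall>H. P H \<longrightarrow> card G \<le> card H"
    using ex_has_least_nat[of P _ card] by blast
  have "\<exists>z. g \<bullet> z < 0 \<and> (\<forall>h\<in>G - {g}. 0 \<le> h \<bullet> z)" if g: "g \<in> G" for g
  proof (rule ccontr)
    assume "\<not> ?thesis"
    then have "P (G - {g})"
      using G(1) unfolding P_def by (auto simp: not_less)
    then have "card G \<le> card (G - {g})" using G(2) by blast
    moreover have "finite G" using G(1) by (simp add: P_def)
    ultimately show False using card_Diff1_less[of G g] g by linarith
  qed
  moreover have "finite G" "C = {x. \<forall>g\<in>G. 0 \<le> g \<bullet> x}" using G(1) unfolding P_def by blast+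
  ultimately show thesis using that[of G] by blast
qed

text \<open>A short move from \<open>u\<close> along \<open>- p\<close> stays in \<open>C\<close>,
  where \<open>p\<close> is nonnegative, but strictly lowers the value of \<open>p\<close>. The last
  assumption says that \<open>u\<close> is an algebraic interior point.\<close>

lemma inner_pos_at_absorbing_point:
  fixes p u :: "'a::real_inner"
  assumes "\<And>y. y \<in> C \<Longrightarrow> 0 \<le> p \<bullet> y" "p \<noteq> 0" "\<And>a. \<exists>\<tau>>0. u + \<tau> *\<^sub>R a \<in> C"
  shows "0 < p \<bullet> u"
proof -
  obtain \<tau> where \<tau>: "\<tau> > 0" "u + \<tau> *\<^sub>R (- p) \<in> C" using assms(3) by blast
  have "0 \<le> p \<bullet> u - \<tau> * (p \<bullet> p)"
    using assms(1)[OF \<tau>(2)] by (simp add: inner_simps)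
  moreover have "0 < \<tau> * (p \<bullet> p)" using \<tau>(1) assms(2) by simp
  ultimately show ?thesis by simp
qed

lemma finite_common_shift:
  fixes \<alpha> \<beta> :: "'b \<Rightarrow> real"
  assumes "finite G" "\<And>g. g \<in> G \<Longrightarrow> 0 < \<alpha> g"
  shows "\<exists>s>0. \<forall>g\<in>G. 0 \<le> \<alpha> g + s * \<beta> g"
  using assms
proof (induction G rule: finite_induct)
  case empty
  show ?case by (auto intro: exI[of _ 1])
next
  case (insert h G)
  then obtain s where s: "s > 0" "\<forall>g\<in>G. 0 \<le> \<alpha> g + s * \<beta> g" by auto
  \<comment> \<open>Shrinking \<open>s\<close> preserves the inequalities already obtained. The
    summand 1 keeps the denominator positive when \<open>\<beta> h = 0\<close>.\<close>
  define s' where "s' = min s (\<alpha> h / (\<bar>\<beta> h\<bar> + 1))"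
  have h: "0 < \<alpha> h" using insert.prems by simp
  have s': "0 < s'" "s' \<le> s" using s(1) h by (auto simp: s'_def)
  have "0 \<le> \<alpha> g + s' * \<beta> g" if "g \<in> G" for g
  proof (cases "\<beta> g \<ge> 0")
    case True
    then show ?thesis using s' insert.prems[of g] that by simp
  next
    case False
    then have "s * \<beta> g \<le> s' * \<beta> g" using s' by simp
    then show ?thesis using s(2) that by fastforce
  qed
  moreover have "0 \<le> \<alpha> h + s' * \<beta> h"
  proof -
    have "s' * \<bar>\<beta> h\<bar> \<le> \<alpha> h / (\<bar>\<beta> h\<bar> + 1) * \<bar>\<beta> h\<bar>"
      by (intro mult_right_mono) (auto simp: s'_def)
    also have "\<dots> \<le> \<alpha> h" using h by (simp add: field_simps)
    finally have "\<bar>s' * \<beta> h\<bar> \<le> \<alpha> h" using s'(1) by (simp add: abs_mult)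
    then show ?thesis by linarith
  qed
  ultimately show ?case using s'(1) by auto
qed

text \<open>The sum of the defining normals works: where it vanishes on \<open>C\<close>, each
  normal vanishes, so \<open>- y\<close> lies in \<open>C\<close> too and salience gives
  \<open>y = 0\<close>.\<close>

lemma polyhedral_cone_positive_functional:
  fixes C :: "'a::euclidean_space set"
  assumes "polyhedral_cone C" "salient C"
  obtains \<sigma> where "\<And>y. y \<in> C \<Longrightarrow> 0 \<le> \<sigma> \<bullet> y" "\<And>y. y \<in> C \<Longrightarrow> \<sigma> \<bullet> y = 0 \<Longrightarrow> y = 0"
proof -
  obtain G where G: "finite G" "C = {x. \<forall>g\<in>G. 0 \<le> g \<bullet> x}"
    using polyhedral_cone_irredundant[OF assms(1)] by blast
  show thesis
  proof
    show "0 \<le> \<Sum>G \<bullet> y" if "y \<in> C" for y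
      using that G by (auto simp: inner_sum_left intro: sum_nonneg)
    show "y = 0" if y: "y \<in> C" "\<Sum>G \<bullet> y = 0" for y
    proof -
      have "\<forall>g\<in>G. g \<bullet> y = 0"
        using y G by (subst (asm) inner_sum_left, subst (asm) sum_nonneg_eq_0_iff) auto
      then have "- y \<in> C" using G by auto
      then have "y \<in> C \<inter> uminus ` C" using y(1) by force
      then show ?thesis using assms(2) by (auto simp: salient_def)
    qed
  qed
qed

text \<open>The slice of \<open>C\<close> at height 1 is a polytope. A constant that works at its
  finitely many vertices works on the slice by convexity, and on \<open>C\<close> by
  homogeneity.\<close>

lemma polyhedral_cone_dominated_functional:
  fixes C :: "'a::euclidean_space set"
  assumes "polyhedral_cone C" "salient C"
    and s: "\<And>y. y \<in> C \<Longrightarrow> 0 \<le> s \<bullet> y" and x: "\<And>y. y \<in> C \<Longrightarrow> s \<bullet> y = 0 \<Longrightarrow> x \<bullet> y = 0"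
  shows "\<exists>c\<ge>0. \<forall>y\<in>C. \<bar>x \<bullet> y\<bar> \<le> c * (s \<bullet> y)"
proof -
  have cone: "convex_cone C" and poly: "polyhedron C"
    using assms(1) by (auto simp: polyhedral_cone_def)
  obtain \<sigma> where \<sigma>: "\<And>y. y \<in> C \<Longrightarrow> 0 \<le> \<sigma> \<bullet> y" "\<And>y. y \<in> C \<Longrightarrow> \<sigma> \<bullet> y = 0 \<Longrightarrow> y = 0"
    using polyhedral_cone_positive_functional[OF assms(1,2)] by metis
  define P where "P = C \<inter> {y. \<sigma> \<bullet> y = 1}"
  \<comment> \<open>By compactness \<open>\<sigma>\<close> has a positive minimum on the unit
    vectors of \<open>C\<close>, and its reciprocal bounds the norm on the slice.\<close>
  have "bounded P"
  proof (cases "C \<inter> sphere 0 1 = {}")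
    case True
    have "y = 0" if "y \<in> C" for y
    proof (rule ccontr)
      assume "y \<noteq> 0"
      then have "(1 / norm y) *\<^sub>R y \<in> C \<inter> sphere 0 1"
        using convex_cone_scaleR[OF cone _ that, of "1 / norm y"] by simp
      then show False using True by blast
    qed
    then have "P \<subseteq> {0}" by (auto simp: P_def)
    then show ?thesis by (metis bounded_insert bounded_empty bounded_subset)
  next
    case False
    have "compact (C \<inter> sphere 0 1)"
      using polyhedron_imp_closed[OF poly] by (simp add: closed_Int_compact)
    moreover have "continuous_on (C \<inter> sphere 0 1) (\<lambda>y. \<sigma> \<bullet> y)" by (intro continuous_intros)
    ultimately have "\<exists>y0\<in>C \<inter> sphere 0 1. \<forall>y\<in>C \<inter> sphere 0 1. \<sigma> \<bullet> y0 \<le> \<sigma> \<bullet> y"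
      using False by (intro continuous_attains_inf)
    then obtain y0 where y0: "y0 \<in> C \<inter> sphere 0 1" "\<forall>y\<in>C \<inter> sphere 0 1. \<sigma> \<bullet> y0 \<le> \<sigma> \<bullet> y"
      by blast
    have m: "0 < \<sigma> \<bullet> y0" using \<sigma>[of y0] y0(1) by force
    have "norm y \<le> 1 / (\<sigma> \<bullet> y0)" if "y \<in> P" for y
    proof -
      have y: "y \<in> C" "\<sigma> \<bullet> y = 1" "y \<noteq> 0" using that by (auto simp: P_def)
      then have "(1 / norm y) *\<^sub>R y \<in> C \<inter> sphere 0 1"
        using convex_cone_scaleR[OF cone _ y(1), of "1 / norm y"] by simp
      with y0(2) have "\<sigma> \<bullet> y0 \<le> \<sigma> \<bullet> ((1 / norm y) *\<^sub>R y)" by blast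
      then show ?thesis using y m by (simp add: field_simps)
    qed
    then show ?thesis by (meson boundedI)
  qed
  moreover have "polyhedron P"
    unfolding P_def using poly by (simp add: polyhedron_hyperplane)
  ultimately obtain B where B: "finite B" "P = convex hull B"
    using polytope_eq_bounded_polyhedron polytope_def by metis
  \<comment> \<open>Vertices with \<open>s \<bullet> b = 0\<close> contribute 0, as division by zero
    yields 0; there \<open>x\<close> vanishes as well, so the bound still holds.\<close>
  define c where "c = (\<Sum>b\<in>B. \<bar>x \<bullet> b\<bar> / (s \<bullet> b))"
  have BC: "b \<in> C" if "b \<in> B" for b
    using that B(2) hull_subset[of B convex] by (auto simp: P_def)
  have c0: "0 \<le> c" unfolding c_def using BC s by (intro sum_nonneg) auto
  define D where "D = {y. 0 \<le> (c *\<^sub>R s - x) \<bullet> y} \<inter> {y. 0 \<le> (c *\<^sub>R s + x) \<bullet> y}"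
  have D_iff: "y \<in> D \<longleftrightarrow> \<bar>x \<bullet> y\<bar> \<le> c * (s \<bullet> y)" for y
    by (auto simp: D_def inner_simps)
  have "b \<in> D" if b: "b \<in> B" for b
  proof (cases "s \<bullet> b = 0")
    case True
    then show ?thesis using x BC[OF b] by (simp add: D_iff)
  next
    case False
    then have pos: "0 < s \<bullet> b" using s[OF BC[OF b]] by simp
    have "\<bar>x \<bullet> b\<bar> / (s \<bullet> b) \<le> c"
      unfolding c_def using BC s B(1) b by (intro member_le_sum) auto
    then show ?thesis using pos by (simp add: D_iff field_simps)
  qed
  moreover have "convex D"
    unfolding D_def by (intro convex_Int convex_halfspace_ge)
  ultimately have PD: "P \<subseteq> D" unfolding B(2) by (intro hull_minimal) auto
  have "\<bar>x \<bullet> y\<bar> \<le> c * (s \<bullet> y)" if y: "y \<in> C" for y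
  proof (cases "y = 0")
    case False
    then have pos: "0 < \<sigma> \<bullet> y" using \<sigma>[OF y] by force
    then have "(1 / (\<sigma> \<bullet> y)) *\<^sub>R y \<in> P"
      using convex_cone_scaleR[OF cone _ y, of "1 / (\<sigma> \<bullet> y)"] by (simp add: P_def)
    then have "\<bar>x \<bullet> ((1 / (\<sigma> \<bullet> y)) *\<^sub>R y)\<bar> \<le> c * (s \<bullet> ((1 / (\<sigma> \<bullet> y)) *\<^sub>R y))"
      using PD D_iff by blast
    then show ?thesis using pos by (simp add: abs_mult field_simps)
  qed simp
  then show ?thesis using c0 by blast
qed

lemma ex_nonzero_orthogonal:
  fixes S :: "'a::euclidean_space set"
  assumes "dim S < DIM('a)"
  shows "\<exists>x. x \<noteq> 0 \<and> (\<forall>y\<in>S. y \<bullet> x = 0)"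
proof (rule orthogonal_to_subspace_exists[OF assms])
  fix x :: 'a assume x: "x \<noteq> 0" "\<And>y. y \<in> span S \<Longrightarrow> real_inner_class.orthogonal x y"
  have "y \<bullet> x = 0" if "y \<in> S" for y
    using x(2)[OF span_base[OF that]] by (simp add: real_inner_class.orthogonal_def inner_commute)
  with x(1) show ?thesis by blast
qed

text \<open>The convex-geometric half of the forward direction, with matrices abstracted away:
  \<open>absorbing\<close> makes \<open>u\<close> an interior point, and \<open>meet\<close> is what
  the compressions will provide.\<close>

lemma simplex_cone_if_face_spans_meet:
  fixes C :: "'a::euclidean_space set"
  assumes "polyhedral_cone C" "salient C"
    and absorbing: "\<And>a. \<exists>\<tau>>0. u + \<tau> *\<^sub>R a \<in> C"
    and meet: "\<And>p q. \<lbrakk>\<And>y. y \<in> C \<Longrightarrow> 0 \<le> p \<bullet> y; \<And>y. y \<in> C \<Longrightarrow> 0 \<le> q \<bullet> y; 0 < p \<bullet> u; 0 < q \<bullet> u\<rbrakk>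
      \<Longrightarrow> span (C \<inter> {y. p \<bullet> y = 0}) \<inter> span (C \<inter> {y. q \<bullet> y = 0})
        \<subseteq> span (C \<inter> {y. p \<bullet> y = 0 \<and> q \<bullet> y = 0})"
  shows "simplex_cone C"
proof -
  have cone: "convex_cone C" using assms(1) by (simp add: polyhedral_cone_def)
  obtain G where G: "finite G" "C = {x. \<forall>g\<in>G. 0 \<le> g \<bullet> x}"
    and irr: "\<forall>g\<in>G. \<exists>z. g \<bullet> z < 0 \<and> (\<forall>h\<in>G - {g}. 0 \<le> h \<bullet> z)"
    using polyhedral_cone_irredundant[OF assms(1)] by blast
  have Gpos: "0 < g \<bullet> u" if "g \<in> G" for g
  proof (rule inner_pos_at_absorbing_point[OF _ _ absorbing])
    show "g \<noteq> 0" using irr that by fastforce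
  qed (use G that in auto)
  have facet: "{x. g \<bullet> x = 0} \<subseteq> span (C \<inter> {x. g \<bullet> x = 0})" if g: "g \<in> G" for g
  proof
    fix a assume "a \<in> {x. g \<bullet> x = 0}"
    then have a: "g \<bullet> a = 0" by simp
    obtain z where z: "g \<bullet> z < 0" "\<forall>h\<in>G - {g}. 0 \<le> h \<bullet> z" using irr g by blast
    \<comment> \<open>A point in the relative interior of the facet cut out by \<open>g\<close>.\<close>
    define w where "w = (g \<bullet> u) *\<^sub>R z - (g \<bullet> z) *\<^sub>R u"
    have w0: "g \<bullet> w = 0" by (simp add: w_def inner_simps)
    have wpos: "0 < h \<bullet> w" if "h \<in> G - {g}" for h
    proof -
      have "0 \<le> (g \<bullet> u) * (h \<bullet> z)" using Gpos[OF g] z(2) that by simp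
      moreover have "(g \<bullet> z) * (h \<bullet> u) < 0" using z(1) Gpos that by (simp add: mult_neg_pos)
      ultimately show ?thesis by (simp add: w_def inner_simps)
    qed
    \<comment> \<open>A short move from \<open>w\<close> along \<open>a\<close> stays in the facet,
      so \<open>a\<close> is a multiple of a difference of two facet points.\<close>
    obtain s where s: "s > 0" "\<forall>h\<in>G - {g}. 0 \<le> h \<bullet> w + s * (h \<bullet> a)"
      using finite_common_shift[of "G - {g}" "\<lambda>h. h \<bullet> w" "\<lambda>h. h \<bullet> a"] wpos G(1) by auto
    have "w + s *\<^sub>R a \<in> C \<inter> {x. g \<bullet> x = 0}"
      using s(2) w0 a by (auto simp: G(2) inner_simps)
    moreover have "w \<in> C \<inter> {x. g \<bullet> x = 0}"
      using wpos w0 by (auto simp: G(2)) (metis Diff_iff empty_iff insert_iff order_refl less_imp_le)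
    ultimately have "(1 / s) *\<^sub>R ((w + s *\<^sub>R a) - w) \<in> span (C \<inter> {x. g \<bullet> x = 0})"
      by (intro span_scale span_diff span_base)
    then show "a \<in> span (C \<inter> {x. g \<bullet> x = 0})" using s(1) by simp
  qed
  \<comment> \<open>Facets are added one at a time. The sum of the normals in \<open>J\<close> cuts
    out exactly the intersection of their facets, so \<open>meet\<close> applies to this sum and
    \<open>g\<close>. The case \<open>J = {}\<close> is separate because the empty sum is not
    positive at \<open>u\<close>.\<close>
  have face: "{a. \<forall>g\<in>J. g \<bullet> a = 0} \<subseteq> span (C \<inter> {a. \<forall>g\<in>J. g \<bullet> a = 0})" if "J \<subseteq> G" for J
  proof -
    have "finite J" using that G(1) finite_subset by blast
    then show ?thesis using that
    proof (induction J rule: finite_induct)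
      case empty
      have "a \<in> span C" for a
      proof -
        obtain \<tau> where \<tau>: "\<tau> > 0" "u + \<tau> *\<^sub>R a \<in> C" using absorbing by blast
        obtain \<tau>' where "u + \<tau>' *\<^sub>R 0 \<in> C" using absorbing[of 0] by blast
        then have "(1 / \<tau>) *\<^sub>R ((u + \<tau> *\<^sub>R a) - u) \<in> span C"
          using \<tau>(2) by (intro span_scale span_diff span_base) simp_all
        then show ?thesis using \<tau>(1) by simp
      qed
      then show ?case by auto
    next
      case (insert g J)
      show ?case
      proof (cases "J = {}")
        case True
        then show ?thesis using facet[of g] insert.prems by simp
      next
        case False
        have Jpos: "0 \<le> h \<bullet> y" if "h \<in> J" "y \<in> C" for h y
          using that insert.prems G(2) by auto
        have J: "C \<inter> {a. \<Sum>J \<bullet> a = 0} = C \<inter> {a. \<forall>g\<in>J. g \<bullet> a = 0}"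
          using Jpos insert.hyps(1) by (auto simp: inner_sum_left sum_nonneg_eq_0_iff)
        have "{a. \<forall>h\<in>insert g J. h \<bullet> a = 0}
            \<subseteq> span (C \<inter> {a. \<Sum>J \<bullet> a = 0}) \<inter> span (C \<inter> {a. g \<bullet> a = 0})"
          using insert.IH insert.prems facet[of g] unfolding J by auto
        also have "\<dots> \<subseteq> span (C \<inter> {a. \<Sum>J \<bullet> a = 0 \<and> g \<bullet> a = 0})"
        proof (rule meet)
          show "0 < \<Sum>J \<bullet> u"
            using insert.prems insert.hyps(1) False Gpos by (auto simp: inner_sum_left intro!: sum_pos)
        qed (use Jpos insert.prems G(2) Gpos in \<open>auto simp: inner_sum_left intro!: sum_nonneg\<close>)
        also have "C \<inter> {a. \<Sum>J \<bullet> a = 0 \<and> g \<bullet> a = 0} = C \<inter> {a. \<forall>h\<in>insert g J. h \<bullet> a = 0}"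
          using J by auto
        finally show ?thesis .
      qed
    qed
  qed
  obtain \<Gamma> where \<Gamma>: "\<Gamma> \<subseteq> G" "independent \<Gamma>" "G \<subseteq> span \<Gamma>"
    using maximal_independent_subset[of G] by metis
  have fin: "finite \<Gamma>" using \<Gamma>(1) G(1) finite_subset by blast
  \<comment> \<open>A common zero of \<open>\<Gamma>\<close> is a zero of all normals, so it and its
    negative lie in \<open>C\<close>. Salience thus makes \<open>\<Gamma>\<close> a basis of the
    space.\<close>
  have sep: "x = 0" if x: "\<And>g. g \<in> \<Gamma> \<Longrightarrow> g \<bullet> x = 0" for x
  proof -
    have "g \<bullet> x = 0" if "g \<in> G" for g
      using span_minimal[OF _ subspace_hyperplane, of \<Gamma> x] x \<Gamma>(3) that by (auto simp: inner_commute)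
    then have "x \<in> C" "- x \<in> C" by (auto simp: G(2))
    then have "x \<in> C \<inter> uminus ` C" by force
    then show ?thesis using assms(2) by (auto simp: salient_def)
  qed
  have card: "card \<Gamma> = DIM('a)"
  proof (rule ccontr)
    assume "card \<Gamma> \<noteq> DIM('a)"
    then have "dim \<Gamma> < DIM('a)"
      using dim_eq_card_independent[OF \<Gamma>(2)] dim_subset_UNIV[of \<Gamma>] by simp
    then obtain x where "x \<noteq> 0" "\<forall>g\<in>\<Gamma>. g \<bullet> x = 0"
      using ex_nonzero_orthogonal by blast
    then show False using sep[of x] by blast
  qed
  \<comment> \<open>The hyperplanes of the other normals share a nonzero vector. By
    \<open>face\<close> their intersection is spanned by points of \<open>C\<close>, so it contains
    a nonzero point of \<open>C\<close>, which is then rescaled.\<close>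
  have "\<exists>b\<in>C. g \<bullet> b = 1 \<and> (\<forall>h\<in>\<Gamma> - {g}. h \<bullet> b = 0)" if g: "g \<in> \<Gamma>" for g
  proof -
    have "dim (\<Gamma> - {g}) < DIM('a)"
      using dim_le_card[of "\<Gamma> - {g}" "\<Gamma> - {g}"] fin g card card_Diff1_less[of \<Gamma> g] DIM_positive[where 'a='a]
      by (simp add: span_superset less_le_not_le)
    then obtain a where a: "a \<noteq> 0" "\<forall>h\<in>\<Gamma> - {g}. h \<bullet> a = 0"
      using ex_nonzero_orthogonal by blast
    then have "a \<in> span (C \<inter> {a. \<forall>h\<in>\<Gamma> - {g}. h \<bullet> a = 0})"
      using face[of "\<Gamma> - {g}"] \<Gamma>(1) by blast
    then have "\<not> C \<inter> {a. \<forall>h\<in>\<Gamma> - {g}. h \<bullet> a = 0} \<subseteq> {0}"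
      using a(1) span_mono[of _ "{0 :: 'a}"] by (auto simp: span_insert_0)
    then obtain b where b: "b \<in> C" "\<forall>h\<in>\<Gamma> - {g}. h \<bullet> b = 0" "b \<noteq> 0" by blast
    have "g \<bullet> b \<noteq> 0" using sep[of b] b(2,3) by blast
    moreover have "0 \<le> g \<bullet> b" using b(1) g \<Gamma>(1) G(2) by auto
    ultimately have "0 < g \<bullet> b" by simp
    then show ?thesis
      using b convex_cone_scaleR[OF cone _ b(1), of "1 / (g \<bullet> b)"]
      by (intro bexI[of _ "(1 / (g \<bullet> b)) *\<^sub>R b"]) auto
  qed
  then obtain b where b: "\<And>g. g \<in> \<Gamma> \<Longrightarrow> b g \<in> C" "\<And>g. g \<in> \<Gamma> \<Longrightarrow> g \<bullet> b g = 1"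
    "\<And>g h. g \<in> \<Gamma> \<Longrightarrow> h \<in> \<Gamma> \<Longrightarrow> h \<noteq> g \<Longrightarrow> h \<bullet> b g = 0"
    by (metis Diff_iff singletonD)
  have inj: "inj_on b \<Gamma>"
    using b by (metis inj_onI zero_neq_one)
  have "independent (b ` \<Gamma>)"
    unfolding dependent_def
  proof (clarify)
    fix g assume g: "g \<in> \<Gamma>" "b g \<in> span (b ` \<Gamma> - {b g})"
    have "span (b ` \<Gamma> - {b g}) \<subseteq> {x. g \<bullet> x = 0}"
      using b g(1) by (intro span_minimal subspace_hyperplane) auto
    then show False using g b(2) by auto
  qed
  moreover have "card (b ` \<Gamma>) = DIM('a)" using card card_image[OF inj] by simp
  moreover have "C = convex_cone hull (b ` \<Gamma>)"
  proof
    show "convex_cone hull (b ` \<Gamma>) \<subseteq> C" using b cone by (intro hull_minimal) auto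
    show "C \<subseteq> convex_cone hull (b ` \<Gamma>)"
    proof
      fix y assume y: "y \<in> C"
      \<comment> \<open>The coordinates of \<open>y\<close> in the dual basis are the values
        \<open>g \<bullet> y\<close>, which are nonnegative on \<open>C\<close>.\<close>
      have "h \<bullet> (\<Sum>g\<in>\<Gamma>. (g \<bullet> y) *\<^sub>R b g) = h \<bullet> y" if h: "h \<in> \<Gamma>" for h
      proof -
        have "h \<bullet> (\<Sum>g\<in>\<Gamma>. (g \<bullet> y) *\<^sub>R b g) = (\<Sum>g\<in>\<Gamma>. (g \<bullet> y) * (h \<bullet> b g))"
          by (simp add: inner_sum_right)
        also have "\<dots> = (\<Sum>g\<in>\<Gamma>. if g = h then h \<bullet> y else 0)"
          using b h by (intro sum.cong) auto
        finally show ?thesis using h fin by simp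
      qed
      then have "y = (\<Sum>g\<in>\<Gamma>. (g \<bullet> y) *\<^sub>R b g)"
        using sep[of "y - (\<Sum>g\<in>\<Gamma>. (g \<bullet> y) *\<^sub>R b g)"] by (simp add: inner_diff_right)
      moreover have "(\<Sum>g\<in>\<Gamma>. (g \<bullet> y) *\<^sub>R b g) \<in> convex_cone hull (b ` \<Gamma>)"
        using y \<Gamma>(1) G(2)
        by (intro convex_cone_sum[OF convex_cone_convex_cone_hull]) (auto intro: hull_inc)
      ultimately show "y \<in> convex_cone hull (b ` \<Gamma>)" by simp
    qed
  qed
  ultimately show ?thesis unfolding simplex_cone_def by blast
qed

section \<open>Hermitian and positive semidefinite forms\<close>

text \<open>Matrices and vectors become total functions of which only the indices below
  \<open>n\<close> count, so no carrier conditions arise.\<close>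

definition sesq :: "nat \<Rightarrow> (nat \<Rightarrow> nat \<Rightarrow> complex) \<Rightarrow> (nat \<Rightarrow> complex) \<Rightarrow> (nat \<Rightarrow> complex) \<Rightarrow> complex" where
  "sesq n A v w = (\<Sum>i<n. \<Sum>j<n. cnj (v i) * A i j * w j)"

text \<open>The value 0 from index \<open>n\<close> on makes equations between images hold as
  equations of functions.\<close>

definition app :: "nat \<Rightarrow> (nat \<Rightarrow> nat \<Rightarrow> complex) \<Rightarrow> (nat \<Rightarrow> complex) \<Rightarrow> nat \<Rightarrow> complex" where
  "app n A v i = (if i < n then \<Sum>j<n. A i j * v j else 0)"

definition sqnorm :: "nat \<Rightarrow> (nat \<Rightarrow> complex) \<Rightarrow> real" where
  "sqnorm n v = (\<Sum>i<n. (cmod (v i))\<^sup>2)"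

definition herm :: "nat \<Rightarrow> (nat \<Rightarrow> nat \<Rightarrow> complex) \<Rightarrow> bool" where
  "herm n A \<longleftrightarrow> (\<forall>i<n. \<forall>j<n. A i j = cnj (A j i))"

lemma sesq_app: "sesq n A v w = (\<Sum>i<n. cnj (v i) * app n A w i)"
  by (simp add: sesq_def app_def sum_distrib_left mult.assoc)

lemma herm_cnj: "herm n A \<Longrightarrow> i < n \<Longrightarrow> j < n \<Longrightarrow> cnj (A i j) = A j i"
  by (metis herm_def)

lemma herm_app_adjoint:
  assumes "herm n A"
  shows "(\<Sum>i<n. cnj (v i) * app n A w i) = (\<Sum>i<n. cnj (app n A v i) * w i)"
proof -
  have "(\<Sum>i<n. cnj (v i) * app n A w i) = (\<Sum>i<n. \<Sum>j<n. cnj (A j i * v i) * w j)"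
    using herm_cnj[OF assms] by (simp add: app_def sum_distrib_left mult_ac)
  also have "\<dots> = (\<Sum>i<n. cnj (app n A v i) * w i)"
    by (subst sum.swap) (simp add: app_def sum_distrib_right)
  finally show ?thesis .
qed

lemma sqnorm_nonneg: "0 \<le> sqnorm n v"
  by (simp add: sqnorm_def sum_nonneg)

lemma cmod_le_sqnorm: "i < n \<Longrightarrow> (cmod (v i))\<^sup>2 \<le> sqnorm n v"
  unfolding sqnorm_def by (rule member_le_sum) auto

lemma sqnorm_add: "sqnorm n (\<lambda>i. v i + w i) \<le> 2 * sqnorm n v + 2 * sqnorm n w"
proof -
  have "(cmod (v i + w i))\<^sup>2 \<le> 2 * (cmod (v i))\<^sup>2 + 2 * (cmod (w i))\<^sup>2" for i
  proof -
    have "(cmod (v i + w i))\<^sup>2 \<le> (cmod (v i) + cmod (w i))\<^sup>2"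
      by (intro power_mono norm_triangle_ineq) simp
    also have "\<dots> \<le> 2 * (cmod (v i))\<^sup>2 + 2 * (cmod (w i))\<^sup>2"
      using sum_squares_bound[of "cmod (v i)" "cmod (w i)"] by (simp add: power2_sum)
    finally show ?thesis .
  qed
  then show ?thesis
    unfolding sqnorm_def sum_distrib_left sum.distrib[symmetric] by (intro sum_mono)
qed

lemma sqnorm_app_le: "sqnorm n (app n A v) \<le> (\<Sum>i<n. (\<Sum>j<n. cmod (A i j))\<^sup>2) * sqnorm n v"
proof -
  have "(cmod (app n A v i))\<^sup>2 \<le> (\<Sum>j<n. cmod (A i j))\<^sup>2 * sqnorm n v" if i: "i < n" for i
  proof -
    have "cmod (app n A v i) \<le> (\<Sum>j<n. cmod (A i j) * cmod (v j))"
      using i norm_sum[of "\<lambda>j. A i j * v j" "{..<n}"] by (simp add: app_def norm_mult)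
    also have "\<dots> \<le> (\<Sum>j<n. cmod (A i j) * sqrt (sqnorm n v))"
      by (intro sum_mono mult_left_mono) (auto intro: real_le_rsqrt cmod_le_sqnorm)
    also have "\<dots> = (\<Sum>j<n. cmod (A i j)) * sqrt (sqnorm n v)"
      by (simp add: sum_distrib_right)
    finally have "(cmod (app n A v i))\<^sup>2 \<le> ((\<Sum>j<n. cmod (A i j)) * sqrt (sqnorm n v))\<^sup>2"
      by (intro power_mono) auto
    then show ?thesis by (simp add: power_mult_distrib sqnorm_nonneg)
  qed
  then show ?thesis
    unfolding sqnorm_def[of n "app n A v"] sum_distrib_right by (intro sum_mono) simp
qed

lemma cmod_sesq_le: "cmod (sesq n A v w) \<le> (\<Sum>i<n. \<Sum>j<n. cmod (A i j)) * (sqnorm n v + sqnorm n w)"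
proof -
  have "cmod (cnj (v i) * A i j * w j) \<le> cmod (A i j) * (sqnorm n v + sqnorm n w)"
    if "i < n" "j < n" for i j
  proof -
    have "cmod (v i) * cmod (w j) \<le> (cmod (v i))\<^sup>2 + (cmod (w j))\<^sup>2"
      using sum_squares_bound[of "cmod (v i)" "cmod (w j)"]
        mult_nonneg_nonneg[OF norm_ge_zero[of "v i"] norm_ge_zero[of "w j"]] by linarith
    also have "\<dots> \<le> sqnorm n v + sqnorm n w"
      using that by (intro add_mono cmod_le_sqnorm)
    finally have "cmod (A i j) * (cmod (v i) * cmod (w j)) \<le> cmod (A i j) * (sqnorm n v + sqnorm n w)"
      by (intro mult_left_mono) auto
    then show ?thesis by (simp add: norm_mult mult_ac)
  qed
  then have "(\<Sum>i<n. \<Sum>j<n. cmod (cnj (v i) * A i j * w j))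
      \<le> (\<Sum>i<n. \<Sum>j<n. cmod (A i j) * (sqnorm n v + sqnorm n w))"
    by (intro sum_mono) auto
  moreover have "cmod (sesq n A v w) \<le> (\<Sum>i<n. \<Sum>j<n. cmod (cnj (v i) * A i j * w j))"
    unfolding sesq_def by (intro order_trans[OF norm_sum] sum_mono norm_sum)
  ultimately show ?thesis by (simp add: sum_distrib_right)
qed

lemma sesq_Suc_herm:
  assumes "herm (Suc n) A"
  shows "sesq (Suc n) A (v(n := c)) (v(n := c)) = sesq n A v v + cnj c * (\<Sum>j<n. A n j * v j)
    + c * cnj (\<Sum>j<n. A n j * v j) + cnj c * c * A n n"
proof -
  have "(\<Sum>i<n. cnj (v i) * A i n * c) = c * cnj (\<Sum>j<n. A n j * v j)"
    unfolding cnj_sum sum_distrib_left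
    using herm_cnj[OF assms] by (simp add: mult_ac)
  then show ?thesis
    by (simp add: sesq_def sum.distrib sum_distrib_left algebra_simps)
qed

text \<open>Cholesky factorization by induction on the size: the Schur complement of the last
  diagonal entry is again positive semidefinite, and the last column contributes one further
  rank-one term.\<close>

lemma psd_gram:
  assumes "herm n A" "\<And>v. 0 \<le> sesq n A v v"
  shows "\<exists>w. \<forall>i<n. \<forall>j<n. A i j = (\<Sum>l<n. w l i * cnj (w l j))"
  using assms
proof (induction n arbitrary: A)
  case 0
  then show ?case by simp
next
  case (Suc n)
  note form = sesq_Suc_herm[OF Suc.prems(1)]
  note herm = herm_cnj[OF Suc.prems(1)]
  define a where "a = Re (A n n)"
  have ann: "A n n = of_real a"
    using herm[of n n] by (simp add: a_def complex_eq_iff)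
  have a0: "0 \<le> a"
    using Suc.prems(2)[of "(\<lambda>_. 0)(n := 1)"] unfolding form
    by (simp add: sesq_def ann less_eq_complex_def)
  have Lzero: "(\<Sum>j<n. A n j * v j) = 0" if "a = 0" for v
  proof -
    define L where "L = (\<Sum>j<n. A n j * v j)"
    \<comment> \<open>With a vanishing diagonal entry the form is affine in \<open>s\<close> with
      slope \<open>- 2 * (cmod L)\<^sup>2\<close>; being nonnegative for all \<open>s\<close> forces
      \<open>L = 0\<close>.\<close>
    have "0 \<le> Re (sesq (Suc n) A (v(n := - of_real s * L)) (v(n := - of_real s * L)))" for s :: real
      using Suc.prems(2) by (simp add: less_eq_complex_def)
    then have *: "0 \<le> Re (sesq n A v v) - 2 * s * (cmod L)\<^sup>2" for s
      unfolding form L_def[symmetric] ann that cmod_power2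
      by (simp add: power2_eq_square algebra_simps)
    show ?thesis
    proof (rule ccontr)
      assume "\<not> ?thesis"
      then have pos: "0 < (cmod L)\<^sup>2" by (simp add: L_def)
      show False
        using *[of "(Re (sesq n A v v) + 1) / (cmod L)\<^sup>2"] *[of 0] pos by simp
    qed
  qed
  have col0: "A i n = 0 \<and> A n i = 0" if "a = 0" "i < n" for i
  proof -
    have "(\<Sum>j<n. A n j * (if j = i then 1 else 0)) = 0" by (rule Lzero[OF that(1)])
    then have "A n i = 0" using that(2) by (simp add: if_distrib cong: if_cong)
    then show ?thesis using herm[of i n] that(2) by simp
  qed
  \<comment> \<open>Schur complement of the last diagonal entry; if that entry is \<open>0\<close>, so is its column and \<open>A' = A\<close>.\<close>
  define A' where "A' i j = A i j - A i n * A n j / of_real a" for i j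
  have "herm n A'"
    unfolding herm_def A'_def by (simp add: herm mult.commute)
  moreover have "0 \<le> sesq n A' v v" for v
  proof -
    define L where "L = (\<Sum>j<n. A n j * v j)"
    have cL: "cnj L = (\<Sum>i<n. cnj (v i) * A i n)"
      unfolding L_def cnj_sum by (simp add: herm mult.commute)
    have "sesq n A' v v = sesq n A v v - (\<Sum>i<n. \<Sum>j<n. (cnj (v i) * A i n) * (A n j * v j)) / of_real a"
      by (simp add: sesq_def A'_def algebra_simps sum_subtractf sum_divide_distrib)
    also have "(\<Sum>i<n. \<Sum>j<n. (cnj (v i) * A i n) * (A n j * v j)) = cnj L * L"
      unfolding cL unfolding L_def by (simp add: sum_product)
    finally have eq: "sesq n A' v v = sesq n A v v - cnj L * L / of_real a" .
    \<comment> \<open>For \<open>a > 0\<close> this last coordinate minimizes the form of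
      \<open>A\<close> for given \<open>v\<close> (completing the square), and the minimum is the
      form of \<open>A'\<close>. For \<open>a = 0\<close> both quotients are 0.\<close>
    define c where "c = - L / of_real a"
    have "sesq (Suc n) A (v(n := c)) (v(n := c)) = sesq n A v v - cnj L * L / of_real a"
      unfolding form L_def[symmetric] ann c_def
      by (cases "a = 0") (simp_all add: field_simps)
    then show ?thesis unfolding eq using Suc.prems(2) by metis
  qed
  ultimately obtain w where w: "\<And>i j. i < n \<Longrightarrow> j < n \<Longrightarrow> A' i j = (\<Sum>l<n. w l i * cnj (w l j))"
    using Suc.IH[of A'] by metis
  \<comment> \<open>The old vectors are padded with 0; the new one is the last column divided by the
    root of its diagonal entry.\<close>
  define w' where "w' l i = (if l < n then if i < n then w l i else 0 else A i n / of_real (sqrt a))" for l i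
  have sq: "of_real (sqrt a) * of_real (sqrt a) = (of_real a :: complex)"
    using a0 by (metis of_real_mult real_sqrt_mult_self abs_of_nonneg)
  have "A i j = (\<Sum>l<Suc n. w' l i * cnj (w' l j))" if ij: "i < Suc n" "j < Suc n" for i j
  proof -
    have "(\<Sum>l<Suc n. w' l i * cnj (w' l j))
      = (\<Sum>l<n. w' l i * cnj (w' l j)) + A i n * A n j / of_real a"
      using herm[of j n] ij sq by (simp add: w'_def)
    also have "(\<Sum>l<n. w' l i * cnj (w' l j)) = (if i < n \<and> j < n then A' i j else 0)"
      using w by (auto simp: w'_def)
    finally show ?thesis
      using ij ann col0 by (cases "a = 0") (auto simp: A'_def less_Suc_eq)
  qed
  then show ?case by blast
qed

text \<open>Write \<open>A = W W^*\<close> by the Gram representation and put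
  \<open>y = W^* v\<close>. The form at \<open>v\<close> is the squared norm of \<open>y\<close>,
  while \<open>A v = W y\<close> has squared norm at most a constant times that.\<close>

lemma psd_sqnorm_app_le:
  assumes "herm n A" "\<And>v. 0 \<le> sesq n A v v"
  shows "\<exists>\<kappa>\<ge>0. \<forall>v. sqnorm n (app n A v) \<le> \<kappa> * Re (sesq n A v v)"
proof -
  obtain w where w: "\<And>i j. i < n \<Longrightarrow> j < n \<Longrightarrow> A i j = (\<Sum>l<n. w l i * cnj (w l j))"
    using psd_gram[OF assms] by metis
  define W where "W i l = w l i" for i l
  define \<kappa> where "\<kappa> = (\<Sum>i<n. (\<Sum>j<n. cmod (W i j))\<^sup>2)"
  have "sqnorm n (app n A v) \<le> \<kappa> * Re (sesq n A v v)" for v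
  proof -
    define y where "y l = (\<Sum>j<n. cnj (w l j) * v j)" for l
    have cy: "cnj (y l) = (\<Sum>j<n. cnj (v j) * w l j)" for l
      by (simp add: y_def mult.commute)
    have app: "app n A v = app n W y"
    proof
      fix i
      show "app n A v i = app n W y i"
      proof (cases "i < n")
        case True
        then have "app n A v i = (\<Sum>j<n. \<Sum>l<n. w l i * (cnj (w l j) * v j))"
          using w by (simp add: app_def sum_distrib_right mult.assoc)
        also have "\<dots> = app n W y i"
          by (subst sum.swap) (use True in \<open>simp add: app_def W_def y_def sum_distrib_left\<close>)
        finally show ?thesis .
      qed (simp add: app_def)
    qed
    have "sesq n A v v = (\<Sum>i<n. \<Sum>l<n. cnj (v i) * w l i * y l)"
      unfolding sesq_app app by (simp add: app_def W_def sum_distrib_left mult.assoc)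
    also have "\<dots> = (\<Sum>l<n. cnj (y l) * y l)"
      by (subst sum.swap) (simp add: cy sum_distrib_right)
    also have "\<dots> = of_real (sqnorm n y)"
      unfolding sqnorm_def of_real_sum complex_norm_square by (simp add: mult.commute)
    finally have "Re (sesq n A v v) = sqnorm n y" by simp
    then show ?thesis using sqnorm_app_le[of n W y] by (simp add: app \<kappa>_def)
  qed
  moreover have "0 \<le> \<kappa>" by (simp add: \<kappa>_def sum_nonneg)
  ultimately show ?thesis by blast
qed

text \<open>A linear map has a linear right inverse on its range; \<open>S\<close> is the matrix of
  such an inverse.\<close>

lemma generalized_inverse: "\<exists>S. \<forall>v. app n A (app n S (app n A v)) = app n A v"
proof -
  let ?s = "\<lambda>c (f :: nat \<Rightarrow> complex) i. c * f i"
  interpret vector_space_pair ?s ?s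
    by unfold_locales (auto simp: algebra_simps fun_eq_iff)
  have "Vector_Spaces.linear ?s ?s (app n A)"
    unfolding Vector_Spaces.linear_iff
    using vs1.vector_space_axioms
    by (auto simp: app_def fun_eq_iff algebra_simps sum.distrib sum_distrib_left)
  then obtain g where g: "Vector_Spaces.linear ?s ?s g" "\<forall>v\<in>range (app n A). app n A (g v) = v"
    using linear_exists_right_inverse_on[OF _ vs1.subspace_UNIV] by blast
  interpret g: Vector_Spaces.linear ?s ?s g by fact
  define e where "e k = (\<lambda>i. if i = k then 1 else 0 :: complex)" for k :: nat
  \<comment> \<open>The inverse \<open>g\<close> acts on all sequences, but images under
    \<open>app n A\<close> vanish from index \<open>n\<close> on, so its values at the first
    \<open>n\<close> unit vectors determine what is needed.\<close>
  define S where "S i k = g (e k) i" for i k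
  have "app n A (app n S y) = app n A (g y)" if y: "\<And>i. i \<ge> n \<Longrightarrow> y i = 0" for y
  proof -
    have ye: "y = (\<Sum>k<n. ?s (y k) (e k))"
    proof
      fix i
      have "(\<Sum>k<n. ?s (y k) (e k)) i = (\<Sum>k<n. if i = k then y k else 0)"
        by (induction n) (auto simp: e_def)
      then show "y i = (\<Sum>k<n. ?s (y k) (e k)) i" using y[of i] by (cases "i < n") auto
    qed
    have "g y = (\<Sum>k<n. ?s (y k) (g (e k)))"
      by (subst ye) (simp add: g.sum g.scale)
    moreover have "(\<Sum>k<m. ?s (y k) (g (e k))) i = (\<Sum>k<m. S i k * y k)" for m i
      by (induction m) (auto simp: S_def)
    ultimately have "g y i = (\<Sum>k<n. S i k * y k)" for i by simp
    then show ?thesis by (auto simp: app_def fun_eq_iff)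
  qed
  from this[of "app n A v" for v] have "app n A (app n S (app n A v)) = app n A (g (app n A v))" for v
    by (simp add: app_def)
  then show ?thesis using g(2) by (metis rangeI)
qed

text \<open>With \<open>A S A = A\<close> and \<open>A\<close> Hermitian, \<open>v\<^sup>* A w = (A v)\<^sup>* S (A w)\<close>.\<close>

lemma herm_sesq_le:
  assumes "herm n A"
  shows "\<exists>\<kappa>\<ge>0. \<forall>v w. cmod (sesq n A v w) \<le> \<kappa> * (sqnorm n (app n A v) + sqnorm n (app n A w))"
proof -
  obtain S where S: "\<And>v. app n A (app n S (app n A v)) = app n A v"
    using generalized_inverse by metis
  have "sesq n A v w = sesq n S (app n A v) (app n A w)" for v w
  proof -
    have "sesq n A v w = (\<Sum>i<n. cnj (v i) * app n A (app n S (app n A w)) i)"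
      by (simp add: sesq_app S)
    also have "\<dots> = sesq n S (app n A v) (app n A w)"
      unfolding sesq_app by (rule herm_app_adjoint[OF assms])
    finally show ?thesis .
  qed
  then have "cmod (sesq n A v w)
      \<le> (\<Sum>i<n. \<Sum>j<n. cmod (S i j)) * (sqnorm n (app n A v) + sqnorm n (app n A w))" for v w
    using cmod_sesq_le by metis
  then show ?thesis by (intro exI[of _ "\<Sum>i<n. \<Sum>j<n. cmod (S i j)"]) (auto intro!: sum_nonneg)
qed

text \<open>If no vector of positive norm is annihilated, then \<open>v - S A v\<close>, lying in
  the kernel, has norm 0. So \<open>v\<close> agrees with \<open>S A v\<close> below
  \<open>n\<close>, and its norm is bounded through \<open>A v\<close> by the form.\<close>

lemma psd_singular_or_definite:
  assumes "herm n A" "\<And>v. 0 \<le> sesq n A v v"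
  shows "(\<exists>v. 0 < sqnorm n v \<and> sesq n A v v = 0) \<or> (\<exists>\<kappa>>0. \<forall>v. sqnorm n v \<le> \<kappa> * Re (sesq n A v v))"
proof (cases "\<exists>v. 0 < sqnorm n v \<and> app n A v = (\<lambda>_. 0)")
  case True
  then show ?thesis by (auto simp: sesq_app)
next
  case False
  obtain S where S: "\<And>v. app n A (app n S (app n A v)) = app n A v"
    using generalized_inverse by metis
  obtain \<kappa> where \<kappa>: "\<kappa> \<ge> 0" "\<And>v. sqnorm n (app n A v) \<le> \<kappa> * Re (sesq n A v v)"
    using psd_sqnorm_app_le[OF assms] by metis
  define \<mu> where "\<mu> = (\<Sum>i<n. (\<Sum>j<n. cmod (S i j))\<^sup>2)"
  have \<mu>: "0 \<le> \<mu>" by (simp add: \<mu>_def sum_nonneg)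
  \<comment> \<open>The summand 1 makes the constant strictly positive even if
    \<open>\<mu> * \<kappa> = 0\<close>.\<close>
  have "sqnorm n v \<le> (\<mu> * \<kappa> + 1) * Re (sesq n A v v)" for v
  proof -
    define z where "z i = v i - app n S (app n A v) i" for i
    have "app n A z i = app n A v i - app n A (app n S (app n A v)) i" for i
      by (simp add: app_def z_def algebra_simps sum_subtractf)
    then have "app n A z = (\<lambda>_. 0)" by (intro ext) (simp add: S)
    then have "sqnorm n z = 0" using False sqnorm_nonneg[of n z] by force
    then have "z i = 0" if "i < n" for i
      using that by (auto simp: sqnorm_def sum_nonneg_eq_0_iff)
    then have "sqnorm n v = sqnorm n (app n S (app n A v))"
      unfolding sqnorm_def z_def by (intro sum.cong) auto
    also have "\<dots> \<le> \<mu> * sqnorm n (app n A v)" unfolding \<mu>_def by (rule sqnorm_app_le)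
    also have "\<dots> \<le> \<mu> * (\<kappa> * Re (sesq n A v v))" using \<mu> \<kappa>(2) by (intro mult_left_mono)
    finally show ?thesis
      using assms(2)[of v] by (simp add: algebra_simps less_eq_complex_def)
  qed
  then show ?thesis using \<mu> \<kappa>(1) by (intro disjI2 exI[of _ "\<mu> * \<kappa> + 1"]) (auto intro: add_nonneg_pos)
qed

section \<open>Pencils of Hermitian matrices\<close>

text \<open>The matrix \<open>M(a)\<close> as an index function, whose entries are linear in
  \<open>a\<close> for every family \<open>M\<close>.\<close>

definition pencil :: "('d::finite \<Rightarrow> complex mat) \<Rightarrow> real ^ 'd \<Rightarrow> nat \<Rightarrow> nat \<Rightarrow> complex" where
  "pencil M a i j = (\<Sum>k\<in>UNIV. complex_of_real (a $h k) * M k $$ (i, j))"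

lemma pencil_axis: "pencil M (axis k 1) i j = M k $$ (i, j)"
proof -
  have "complex_of_real (axis k 1 $h l) * M l $$ (i, j) = (if l = k then M l $$ (i, j) else 0)" for l
    by (simp add: axis_def)
  then show ?thesis by (simp add: pencil_def)
qed

lemma linear_pencil: "linear (\<lambda>a. pencil M a i j)"
  by (rule Real_Vector_Spaces.linearI)
     (simp_all add: pencil_def algebra_simps sum.distrib scaleR_sum_right scaleR_conv_of_real[where 'a = complex] sum_distrib_left)

lemma sesq_pencil:
  "sesq n (pencil M a) v w = (\<Sum>k\<in>UNIV. complex_of_real (a $h k) * sesq n (\<lambda>i j. M k $$ (i, j)) v w)"
proof -
  have "sesq n (pencil M a) v w
      = (\<Sum>i<n. \<Sum>k\<in>UNIV. \<Sum>j<n. complex_of_real (a $h k) * (cnj (v i) * M k $$ (i, j) * w j))"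
    unfolding sesq_def pencil_def sum_distrib_left sum_distrib_right
    by (intro sum.cong refl, subst sum.swap) (simp add: mult_ac)
  also have "\<dots> = (\<Sum>k\<in>UNIV. complex_of_real (a $h k) * sesq n (\<lambda>i j. M k $$ (i, j)) v w)"
    by (subst sum.swap) (simp add: sesq_def sum_distrib_left)
  finally show ?thesis .
qed

lemma linear_sesq_pencil: "linear (\<lambda>a. sesq n (pencil M a) v w)"
  by (rule Real_Vector_Spaces.linearI)
     (simp_all add: sesq_pencil algebra_simps sum.distrib scaleR_sum_right scaleR_conv_of_real[where 'a = complex] sum_distrib_left)

lemma sesq_pencil_add: "sesq n (pencil M (a + b)) v w = sesq n (pencil M a) v w + sesq n (pencil M b) v w"
  using linear_sesq_pencil by (rule linear_add)

lemma sesq_pencil_scaleR: "sesq n (pencil M (c *\<^sub>R a)) v w = complex_of_real c * sesq n (pencil M a) v w"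
  using linear_scale[OF linear_sesq_pencil] by (simp add: scaleR_conv_of_real)

section \<open>Translation from matrices with carriers to index functions\<close>

lemma mat_adjoint_index:
  fixes A :: "complex mat"
  assumes "i < dim_col A" "j < dim_row A"
  shows "mat_adjoint A $$ (i, j) = cnj (A $$ (j, i))"
  using assms by (simp add: mat_adjoint_def mat_of_rows_def)

lemma mat_adjoint_carrier: "A \<in> carrier_mat m n \<Longrightarrow> mat_adjoint A \<in> carrier_mat n m"
  by (intro carrier_matI) (auto simp: mat_adjoint_def)

lemma Her_iff: "A \<in> Her n \<longleftrightarrow> A \<in> carrier_mat n n \<and> herm n (\<lambda>i j. A $$ (i, j))"
proof (cases "A \<in> carrier_mat n n")
  case True
  have adj: "mat_adjoint A $$ (i, j) = cnj (A $$ (j, i))" if "i < n" "j < n" for i j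
    using True that by (intro mat_adjoint_index) auto
  have "mat_adjoint A = A \<longleftrightarrow> (\<forall>i<n. \<forall>j<n. mat_adjoint A $$ (i, j) = A $$ (i, j))"
    using True mat_adjoint_carrier[OF True] by (metis carrier_matD eq_matI)
  also have "\<dots> \<longleftrightarrow> herm n (\<lambda>i j. A $$ (i, j))"
    unfolding herm_def using adj by metis
  finally show ?thesis using True by (simp add: Her_def)
qed (simp add: Her_def)

lemma mat_lincomb_carrier: "mat_lincomb n a M \<in> carrier_mat n n"
  by (simp add: mat_lincomb_def mat_sum_def)

lemma mat_lincomb_index:
  assumes "\<forall>k. M k \<in> Her n" "i < n" "j < n"
  shows "mat_lincomb n a M $$ (i, j) = pencil M a i j"
proof -
  have M: "M k \<in> carrier_mat n n" for k using assms(1) by (simp add: Her_def)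
  have "(complex_of_real (a $h k) \<cdot>\<^sub>m M k) $$ (i, j) = complex_of_real (a $h k) * M k $$ (i, j)" for k
    using carrier_matD[OF M[of k]] assms(2,3) by simp
  then show ?thesis using assms(2,3) by (simp add: mat_lincomb_def mat_sum_def pencil_def)
qed

lemma herm_pencil:
  assumes "\<forall>k. M k \<in> Her n"
  shows "herm n (pencil M a)"
proof -
  have "cnj (M k $$ (j, i)) = M k $$ (i, j)" if "i < n" "j < n" for i j k
    using assms that unfolding Her_iff by (metis herm_cnj)
  then show ?thesis by (simp add: herm_def pencil_def)
qed

lemma psd_iff:
  assumes "X \<in> carrier_mat n n"
  shows "psd n X \<longleftrightarrow> herm n (\<lambda>i j. X $$ (i, j)) \<and> (\<forall>v. 0 \<le> sesq n (\<lambda>i j. X $$ (i, j)) v v)"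
proof -
  have form: "(X *\<^sub>v v) \<bullet>c v = sesq n (\<lambda>i j. X $$ (i, j)) (\<lambda>i. v $ i) (\<lambda>i. v $ i)" if "v \<in> carrier_vec n" for v
    using assms that
    by (auto simp: scalar_prod_def sesq_def sum_distrib_left sum_distrib_right lessThan_atLeast0 mult_ac intro!: sum.cong)
  have cong: "sesq n A (\<lambda>i. vec n v $ i) (\<lambda>i. vec n v $ i) = sesq n A v v" for A and v :: "nat \<Rightarrow> complex"
    by (simp add: sesq_def)
  have "(\<forall>v\<in>carrier_vec n. 0 \<le> (X *\<^sub>v v) \<bullet>c v) \<longleftrightarrow> (\<forall>v. 0 \<le> sesq n (\<lambda>i j. X $$ (i, j)) v v)"
  proof (intro iffI allI ballI)
    fix v :: "nat \<Rightarrow> complex" assume *: "\<forall>v\<in>carrier_vec n. 0 \<le> (X *\<^sub>v v) \<bullet>c v"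
    have "vec n v \<in> carrier_vec n" by simp
    with * show "0 \<le> sesq n (\<lambda>i j. X $$ (i, j)) v v" using form cong by metis
  qed (simp add: form)
  then show ?thesis using assms by (simp add: psd_def Her_iff)
qed

lemma sesq_cong: "(\<And>i j. i < n \<Longrightarrow> j < n \<Longrightarrow> A i j = B i j) \<Longrightarrow> sesq n A v w = sesq n B v w"
  by (simp add: sesq_def)

lemma S1_iff:
  assumes "\<forall>k. M k \<in> Her n"
  shows "a \<in> S1 n M \<longleftrightarrow> (\<forall>v. 0 \<le> sesq n (pencil M a) v v)"
proof -
  have "sesq n (\<lambda>i j. mat_lincomb n a M $$ (i, j)) v v = sesq n (pencil M a) v v" for v
    by (rule sesq_cong) (simp add: mat_lincomb_index[OF assms])
  moreover have "herm n (\<lambda>i j. mat_lincomb n a M $$ (i, j))"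
    using herm_cnj[OF herm_pencil[OF assms, of a]] unfolding herm_def
    by (simp add: mat_lincomb_index[OF assms])
  ultimately show ?thesis
    unfolding S1_def using psd_iff[OF mat_lincomb_carrier, of n a M] by simp
qed

lemma herm_sesq_real:
  assumes "herm n A"
  shows "Im (sesq n A v v) = 0"
proof -
  have "cnj (sesq n A v v) = (\<Sum>i<n. cnj (app n A v i) * v i)"
    by (simp add: sesq_app mult.commute)
  also have "\<dots> = sesq n A v v"
    by (simp add: sesq_app herm_app_adjoint[OF assms])
  finally show ?thesis by (simp add: complex_eq_iff)
qed

lemma sesq_pencil_unit:
  assumes "\<forall>k. M k \<in> Her n" "mat_lincomb n u M = 1\<^sub>m n"
  shows "sesq n (pencil M u) v v = complex_of_real (sqnorm n v)"
proof -
  have "pencil M u i j = (if i = j then 1 else 0)" if "i < n" "j < n" for i j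
    using mat_lincomb_index[OF assms(1) that, of u] assms(2) that by simp
  then have "sesq n (pencil M u) v v = (\<Sum>i<n. \<Sum>j<n. if i = j then cnj (v i) * v j else 0)"
    unfolding sesq_def by (intro sum.cong) auto
  also have "\<dots> = complex_of_real (sqnorm n v)"
    unfolding sqnorm_def of_real_sum complex_norm_square by (simp add: mult.commute)
  finally show ?thesis .
qed

text \<open>A definite \<open>M(y)\<close> dominates a small multiple of any \<open>M(a)\<close>, so
  \<open>y\<close> is an algebraic interior point. This serves at \<open>u\<close>, and also to show
  that \<open>M\<close> is singular at a boundary point of a simplex cone.\<close>

lemma S1_absorbing:
  assumes her: "\<forall>k. M k \<in> Her n" and y: "0 < \<kappa>" "\<And>v. sqnorm n v \<le> \<kappa> * Re (sesq n (pencil M y) v v)"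
  shows "\<exists>\<tau>>0. y + \<tau> *\<^sub>R a \<in> S1 n M"
proof -
  define \<mu> where "\<mu> = (\<Sum>i<n. \<Sum>j<n. cmod (pencil M a i j))"
  have \<mu>: "0 \<le> \<mu>" by (simp add: \<mu>_def sum_nonneg)
  \<comment> \<open>Chosen so that the perturbation is at most \<open>sqnorm n v / \<kappa>\<close>,
    the guaranteed lower bound of the form at \<open>y\<close>.\<close>
  define \<tau> where "\<tau> = 1 / (2 * \<kappa> * (\<mu> + 1))"
  have \<tau>: "0 < \<tau>" using y(1) \<mu> by (simp add: \<tau>_def)
  have "0 \<le> sesq n (pencil M (y + \<tau> *\<^sub>R a)) v v" for v
  proof -
    have "cmod (sesq n (pencil M a) v v) \<le> \<mu> * (2 * sqnorm n v)"
      using cmod_sesq_le[of n "pencil M a" v v] unfolding \<mu>_def[symmetric] by (simp only: mult_2)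
    then have "\<bar>Re (sesq n (pencil M a) v v)\<bar> \<le> \<mu> * (2 * sqnorm n v)"
      using abs_Re_le_cmod order_trans by blast
    then have "\<bar>\<tau> * Re (sesq n (pencil M a) v v)\<bar> \<le> \<tau> * (\<mu> * (2 * sqnorm n v))"
      using \<tau> by (simp add: abs_mult)
    also have "\<dots> \<le> \<tau> * ((\<mu> + 1) * (2 * sqnorm n v))"
      using \<tau> sqnorm_nonneg[of n v] by (intro mult_left_mono mult_right_mono) auto
    also have "\<dots> = sqnorm n v / \<kappa>"
      using \<mu> y(1) by (simp add: \<tau>_def)
    also have "\<dots> \<le> Re (sesq n (pencil M y) v v)"
      using y(2)[of v] y(1) by (simp add: field_simps)
    finally have "0 \<le> Re (sesq n (pencil M (y + \<tau> *\<^sub>R a)) v v)"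
      by (simp add: sesq_pencil_add sesq_pencil_scaleR)
    then show ?thesis
      using herm_sesq_real[OF herm_pencil[OF her]] by (simp add: less_eq_complex_def)
  qed
  then show ?thesis using \<tau> by (auto simp: S1_iff[OF her])
qed

text \<open>In matrix terms, \<open>M(a)^2\<close> is dominated by some \<open>M(h)\<close> with
  \<open>h\<close> in the cone itself, although \<open>a\<close> is only in its span. For generators
  this is \<open>psd_sqnorm_app_le\<close>; in a linear combination signs disappear on
  squaring.\<close>

lemma span_sqnorm_app_le:
  assumes her: "\<forall>k. M k \<in> Her n" and H: "convex_cone H" "H \<subseteq> S1 n M" and a: "a \<in> span H"
  shows "\<exists>h\<in>H. \<forall>v. sqnorm n (app n (pencil M a) v) \<le> Re (sesq n (pencil M h) v v)"
  using a
proof (induction rule: span_induct_alt)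
  case base
  have "sqnorm n (app n (pencil M 0) v) = 0" for v
    by (simp add: sqnorm_def app_def pencil_def)
  moreover have "Re (sesq n (pencil M 0) v v) = 0" for v
    by (simp add: sesq_pencil)
  ultimately show ?case using convex_cone_contains_0[OF H(1)] by (metis order_refl)
next
  case (step c x y)
  obtain h where h: "h \<in> H" "\<And>v. sqnorm n (app n (pencil M y) v) \<le> Re (sesq n (pencil M h) v v)"
    using step by metis
  have "x \<in> S1 n M" using step(1) H(2) by blast
  then have psd: "0 \<le> sesq n (pencil M x) v v" for v by (simp add: S1_iff[OF her])
  obtain \<kappa> where \<kappa>: "\<kappa> \<ge> 0" "\<And>v. sqnorm n (app n (pencil M x) v) \<le> \<kappa> * Re (sesq n (pencil M x) v v)"
    using psd_sqnorm_app_le[OF herm_pencil[OF her] psd] by metis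
  have "sqnorm n (app n (pencil M (c *\<^sub>R x + y)) v)
      \<le> Re (sesq n (pencil M ((2 * c\<^sup>2 * \<kappa>) *\<^sub>R x + 2 *\<^sub>R h)) v v)" for v
  proof -
    have "app n (pencil M (c *\<^sub>R x + y)) v = (\<lambda>i. complex_of_real c * app n (pencil M x) v i + app n (pencil M y) v i)"
      by (auto simp: fun_eq_iff app_def linear_add[OF linear_pencil] linear_scale[OF linear_pencil]
        algebra_simps sum.distrib sum_distrib_left scaleR_conv_of_real[where 'a = complex])
    then have "sqnorm n (app n (pencil M (c *\<^sub>R x + y)) v)
        \<le> 2 * sqnorm n (\<lambda>i. complex_of_real c * app n (pencil M x) v i) + 2 * sqnorm n (app n (pencil M y) v)"
      using sqnorm_add by metis
    also have "sqnorm n (\<lambda>i. complex_of_real c * app n (pencil M x) v i) = c\<^sup>2 * sqnorm n (app n (pencil M x) v)"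
      by (simp add: sqnorm_def norm_mult power_mult_distrib sum_distrib_left)
    also have "\<dots> \<le> c\<^sup>2 * (\<kappa> * Re (sesq n (pencil M x) v v))"
      by (intro mult_left_mono \<kappa>(2)) simp
    finally show ?thesis
      using h(2)[of v] by (simp add: sesq_pencil_add sesq_pencil_scaleR)
  qed
  moreover have "(2 * c\<^sup>2 * \<kappa>) *\<^sub>R x + 2 *\<^sub>R h \<in> H"
    using H(1) step(1) h(1) \<kappa>(1) by (intro convex_cone_add convex_cone_scaleR) auto
  ultimately show ?case by blast
qed

text \<open>As \<open>M(a)\<close> is Hermitian, \<open>v^* M(a) w\<close> is controlled by the
  squared norms of \<open>M(a) v\<close> and \<open>M(a) w\<close>. The first is bounded using
  \<open>H\<close>, the second using \<open>K\<close>, which is where membership of \<open>a\<close>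
  in both spans enters.\<close>

lemma offdiag_sesq_le:
  assumes her: "\<forall>k. M k \<in> Her n"
    and H: "convex_cone H" "H \<subseteq> S1 n M" "a \<in> span H"
    and K: "convex_cone K" "K \<subseteq> S1 n M" "a \<in> span K"
  shows "\<exists>h\<in>H. \<exists>k\<in>K. \<forall>v w. cmod (sesq n (pencil M a) v w)
    \<le> Re (sesq n (pencil M h) v v) + Re (sesq n (pencil M k) w w)"
proof -
  obtain h where h: "h \<in> H" "\<And>v. sqnorm n (app n (pencil M a) v) \<le> Re (sesq n (pencil M h) v v)"
    using span_sqnorm_app_le[OF her H] by metis
  obtain k where k: "k \<in> K" "\<And>v. sqnorm n (app n (pencil M a) v) \<le> Re (sesq n (pencil M k) v v)"
    using span_sqnorm_app_le[OF her K] by metis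
  obtain \<kappa> where \<kappa>: "\<kappa> \<ge> 0"
    "\<And>v w. cmod (sesq n (pencil M a) v w) \<le> \<kappa> * (sqnorm n (app n (pencil M a) v) + sqnorm n (app n (pencil M a) w))"
    using herm_sesq_le[OF herm_pencil[OF her]] by metis
  have "cmod (sesq n (pencil M a) v w)
    \<le> Re (sesq n (pencil M (\<kappa> *\<^sub>R h)) v v) + Re (sesq n (pencil M (\<kappa> *\<^sub>R k)) w w)" for v w
  proof -
    note \<kappa>(2)[of v w]
    also have "\<kappa> * (sqnorm n (app n (pencil M a) v) + sqnorm n (app n (pencil M a) w))
      \<le> \<kappa> * (Re (sesq n (pencil M h) v v) + Re (sesq n (pencil M k) w w))"
      by (intro mult_left_mono add_mono h(2) k(2) \<kappa>(1))
    finally show ?thesis by (simp add: sesq_pencil_scaleR algebra_simps)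
  qed
  moreover have "\<kappa> *\<^sub>R h \<in> H" "\<kappa> *\<^sub>R k \<in> K"
    using \<kappa>(1) h(1) k(1) H(1) K(1) by (auto intro: convex_cone_scaleR)
  ultimately show ?thesis by blast
qed

lemma adjoint_mult_index:
  assumes "V \<in> carrier_mat r t" "A \<in> carrier_mat r r" "p < t" "q < t"
  shows "(mat_adjoint V * A * V) $$ (p, q)
    = sesq r (\<lambda>i j. A $$ (i, j)) (\<lambda>i. V $$ (i, p)) (\<lambda>i. V $$ (i, q))"
proof -
  have adj: "mat_adjoint V \<in> carrier_mat t r"
    using assms(1) by (rule mat_adjoint_carrier)
  have "(mat_adjoint V * A * V) $$ (p, q)
      = (\<Sum>i<r. cnj (V $$ (i, p)) * (\<Sum>j<r. A $$ (i, j) * V $$ (j, q)))"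
    using assms adj by (simp add: scalar_prod_def mat_adjoint_index lessThan_atLeast0)
  then show ?thesis by (simp add: sesq_def sum_distrib_left mult.assoc)
qed

text \<open>The columns of the \<open>V j\<close> act as test vectors: bounds on forms of
  \<open>M\<close> become bounds on the entries of \<open>N\<close>.\<close>

lemma pencil_compression:
  assumes "\<forall>i. M i \<in> Her r" "\<forall>j<k. V j \<in> carrier_mat r t"
    "\<forall>i. mat_sum t t (\<lambda>j. mat_adjoint (V j) * M i * V j) {..<k} = N i" "p < t" "q < t"
  shows "pencil N a p q = (\<Sum>j<k. sesq r (pencil M a) (\<lambda>i. V j $$ (i, p)) (\<lambda>i. V j $$ (i, q)))"
proof -
  have M: "M i \<in> carrier_mat r r" for i using assms(1) by (auto simp: Her_def)
  have "N i $$ (p, q) = (\<Sum>j<k. sesq r (\<lambda>x y. M i $$ (x, y)) (\<lambda>x. V j $$ (x, p)) (\<lambda>x. V j $$ (x, q)))" for i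
  proof -
    have "N i $$ (p, q) = (\<Sum>j<k. (mat_adjoint (V j) * M i * V j) $$ (p, q))"
      using assms(3)[rule_format, of i, symmetric] assms(4,5) by (simp add: mat_sum_def)
    also have "\<dots> = (\<Sum>j<k. sesq r (\<lambda>x y. M i $$ (x, y)) (\<lambda>x. V j $$ (x, p)) (\<lambda>x. V j $$ (x, q)))"
      using assms(2,4,5) M by (intro sum.cong refl adjoint_mult_index) auto
    finally show ?thesis .
  qed
  then show ?thesis
    unfolding sesq_pencil by (subst sum.swap) (simp add: pencil_def sum_distrib_left)
qed

section \<open>Compressions of pencils\<close>

lemma sum_lessThan_2: "(\<Sum>i<2. f i) = f 0 + f (1::nat)"
  by (simp add: numeral_2_eq_2)

text \<open>The hypothesis gives that the absolute value of \<open>x\<close> is at most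
  \<open>sqrt p * sqrt q\<close>, so the cross term is absorbed by the square of
  \<open>sqrt p * cmod (v 0) - sqrt q * cmod (v 1)\<close>.\<close>

lemma real_symmetric_2_form_nonneg:
  fixes p q x :: real
  assumes "0 \<le> p" "0 \<le> q" "x\<^sup>2 \<le> p * q"
    and A: "A 0 0 = of_real p" "A 0 1 = of_real x" "A 1 0 = of_real x" "A 1 1 = of_real q"
  shows "0 \<le> sesq 2 A v v"
proof -
  define z where "z = cnj (v 0) * v 1"
  have form: "sesq 2 A v v = complex_of_real (p * (cmod (v 0))\<^sup>2 + q * (cmod (v 1))\<^sup>2 + 2 * (x * Re z))"
    unfolding sesq_def sum_lessThan_2 A z_def cmod_power2
    by (simp add: complex_eq_iff power2_eq_square algebra_simps)
  have "\<bar>x\<bar> \<le> sqrt p * sqrt q"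
    using real_sqrt_le_mono[OF assms(3)] by (simp add: real_sqrt_mult)
  moreover have "\<bar>Re z\<bar> \<le> cmod (v 0) * cmod (v 1)"
    using abs_Re_le_cmod[of z] by (simp add: z_def norm_mult)
  ultimately have "\<bar>x * Re z\<bar> \<le> (sqrt p * sqrt q) * (cmod (v 0) * cmod (v 1))"
    unfolding abs_mult using assms(1,2) by (intro mult_mono) auto
  moreover have "0 \<le> (sqrt p * cmod (v 0) - sqrt q * cmod (v 1))\<^sup>2" by simp
  then have "2 * ((sqrt p * sqrt q) * (cmod (v 0) * cmod (v 1))) \<le> p * (cmod (v 0))\<^sup>2 + q * (cmod (v 1))\<^sup>2"
    using assms(1,2) by (simp add: power2_diff power_mult_distrib algebra_simps)
  ultimately have "0 \<le> p * (cmod (v 0))\<^sup>2 + q * (cmod (v 1))\<^sup>2 + 2 * (x * Re z)" by linarith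
  then show ?thesis unfolding form by (simp add: less_eq_complex_def)
qed

text \<open>The pencil with diagonal \<open>p\<close>, \<open>q\<close> and off-diagonal
  \<open>x\<close> satisfies the requirements of \<open>compress\<close>. Its entry
  \<open>x \<bullet> a\<close> becomes a sum of terms \<open>v^* M(a) w\<close>; summing
  \<open>bound\<close> turns the right-hand side into the diagonal entries at \<open>h\<close> and
  \<open>k\<close>.\<close>

lemma offdiag_compression_le:
  fixes M :: "'d::finite \<Rightarrow> complex mat"
  assumes her: "\<forall>k. M k \<in> Her r"
    and compress: "\<And>N :: 'd \<Rightarrow> complex mat. \<forall>i. N i \<in> Her 2 \<Longrightarrow> mat_lincomb 2 u N = 1\<^sub>m 2 \<Longrightarrow> S1 r M \<subseteq> S1 2 N \<Longrightarrow>
      \<exists>(k::nat) V. (\<forall>j<k. V j \<in> carrier_mat r 2) \<and>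
        (\<forall>i. mat_sum 2 2 (\<lambda>j. mat_adjoint (V j) * M i * V j) {..<k} = N i)"
    and unit: "p \<bullet> u = 1" "q \<bullet> u = 1" "x \<bullet> u = 0"
    and pos: "\<And>y. y \<in> S1 r M \<Longrightarrow> 0 \<le> p \<bullet> y" "\<And>y. y \<in> S1 r M \<Longrightarrow> 0 \<le> q \<bullet> y"
      "\<And>y. y \<in> S1 r M \<Longrightarrow> (x \<bullet> y)\<^sup>2 \<le> (p \<bullet> y) * (q \<bullet> y)"
    and bound: "\<And>v w. cmod (sesq r (pencil M a) v w) \<le> Re (sesq r (pencil M h) v v) + Re (sesq r (pencil M k) w w)"
  shows "\<bar>x \<bullet> a\<bar> \<le> p \<bullet> h + q \<bullet> k"
proof -
  define c where "c i j = (if i = j then if i = 0 then p else q else x)" for i j :: nat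
  define N :: "'d \<Rightarrow> complex mat" where "N l = mat 2 2 (\<lambda>(i, j). complex_of_real (c i j $h l))" for l
  have pencil_N: "pencil N y i j = complex_of_real (c i j \<bullet> y)" if "i < 2" "j < 2" for y i j
    using that by (simp add: pencil_def N_def inner_vec_def mult.commute)
  have her_N: "\<forall>l. N l \<in> Her 2"
    by (auto simp: Her_iff N_def herm_def c_def)
  moreover have "mat_lincomb 2 u N = 1\<^sub>m 2"
  proof (rule eq_matI)
    fix i j assume "i < dim_row (1\<^sub>m 2 :: complex mat)" "j < dim_col (1\<^sub>m 2 :: complex mat)"
    then have ij: "i < 2" "j < 2" by simp_all
    then show "mat_lincomb 2 u N $$ (i, j) = (1\<^sub>m 2 :: complex mat) $$ (i, j)"
      unfolding mat_lincomb_index[OF her_N ij] pencil_N[OF ij] using unit by (simp add: c_def)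
  qed (use mat_lincomb_carrier[of 2 u N] in auto)
  moreover have "S1 r M \<subseteq> S1 2 N"
  proof
    fix y assume "y \<in> S1 r M"
    then have "0 \<le> sesq 2 (pencil N y) v v" for v
      by (intro real_symmetric_2_form_nonneg[OF pos]) (simp_all add: pencil_N c_def)
    then show "y \<in> S1 2 N" by (simp add: S1_iff[OF her_N])
  qed
  ultimately obtain m V where V: "\<forall>j<(m::nat). V j \<in> carrier_mat r 2"
    "\<forall>i. mat_sum 2 2 (\<lambda>j. mat_adjoint (V j) * M i * V j) {..<m} = N i"
    using compress[of N] by blast
  define v w where "v j = (\<lambda>i. V j $$ (i, 0))" and "w j = (\<lambda>i. V j $$ (i, 1))" for j
  have entries: "complex_of_real (x \<bullet> a) = (\<Sum>j<m. sesq r (pencil M a) (v j) (w j))"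
    "complex_of_real (p \<bullet> h) = (\<Sum>j<m. sesq r (pencil M h) (v j) (v j))"
    "complex_of_real (q \<bullet> k) = (\<Sum>j<m. sesq r (pencil M k) (w j) (w j))"
    using pencil_compression[OF her V, of 0 1 a] pencil_compression[OF her V, of 0 0 h]
      pencil_compression[OF her V, of 1 1 k]
    by (simp_all add: pencil_N c_def v_def w_def)
  have "\<bar>x \<bullet> a\<bar> = cmod (\<Sum>j<m. sesq r (pencil M a) (v j) (w j))"
    unfolding entries(1)[symmetric] by simp
  also have "\<dots> \<le> (\<Sum>j<m. Re (sesq r (pencil M h) (v j) (v j)) + Re (sesq r (pencil M k) (w j) (w j)))"
    by (intro order_trans[OF norm_sum] sum_mono bound)
  also have "\<dots> = p \<bullet> h + q \<bullet> k"
    using arg_cong[OF entries(2), of Re] arg_cong[OF entries(3), of Re] by (simp add: sum.distrib)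
  finally show ?thesis .
qed

lemma face_spans_meet:
  fixes M :: "'d::finite \<Rightarrow> complex mat"
  assumes her: "\<forall>k. M k \<in> Her r"
    and cone: "polyhedral_cone (S1 r M)" "salient (S1 r M)"
    and compress: "\<And>N :: 'd \<Rightarrow> complex mat. \<forall>i. N i \<in> Her 2 \<Longrightarrow> mat_lincomb 2 u N = 1\<^sub>m 2 \<Longrightarrow> S1 r M \<subseteq> S1 2 N \<Longrightarrow>
      \<exists>(k::nat) V. (\<forall>j<k. V j \<in> carrier_mat r 2) \<and>
        (\<forall>i. mat_sum 2 2 (\<lambda>j. mat_adjoint (V j) * M i * V j) {..<k} = N i)"
    and u: "u \<noteq> 0" "u \<in> S1 r M"
    and p: "\<And>y. y \<in> S1 r M \<Longrightarrow> 0 \<le> p \<bullet> y" "p \<bullet> u = 1"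
    and q: "\<And>y. y \<in> S1 r M \<Longrightarrow> 0 \<le> q \<bullet> y" "q \<bullet> u = 1"
  shows "span (S1 r M \<inter> {y. p \<bullet> y = 0}) \<inter> span (S1 r M \<inter> {y. q \<bullet> y = 0})
    \<subseteq> span (S1 r M \<inter> {y. p \<bullet> y = 0 \<and> q \<bullet> y = 0})"
proof
  fix a assume a: "a \<in> span (S1 r M \<inter> {y. p \<bullet> y = 0}) \<inter> span (S1 r M \<inter> {y. q \<bullet> y = 0})"
  define K where "K = S1 r M \<inter> {y. p \<bullet> y = 0 \<and> q \<bullet> y = 0}"
  have pa: "p \<bullet> a = 0"
    using a span_minimal[OF _ subspace_hyperplane, of "S1 r M \<inter> {y. p \<bullet> y = 0}" p] by blast
  show "a \<in> span (S1 r M \<inter> {y. p \<bullet> y = 0 \<and> q \<bullet> y = 0})"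
  proof (rule ccontr)
    assume "\<not> ?thesis"
    then have aK: "a \<notin> span K" by (simp add: K_def)
    \<comment> \<open>The component \<open>z\<close> of \<open>a\<close> orthogonal to
      \<open>span K\<close> is a functional that vanishes on \<open>K\<close> but not at
      \<open>a\<close>.\<close>
    obtain y0 z where z: "y0 \<in> span K" "\<And>w. w \<in> span K \<Longrightarrow> real_inner_class.orthogonal z w" "a = y0 + z"
      by (rule orthogonal_subspace_decomp_exists[of K a], rule that)
    have "z \<bullet> a = z \<bullet> z"
      using z by (simp add: inner_add_right real_inner_class.orthogonal_def)
    moreover have "z \<noteq> 0" using z aK by auto
    ultimately have za: "z \<bullet> a \<noteq> 0" by simp
    have zK: "z \<bullet> y = 0" if "y \<in> K" for y
      using z(2)[OF span_base[OF that]] by (simp add: real_inner_class.orthogonal_def)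
    \<comment> \<open>The correction makes \<open>x\<close> vanish at \<open>u\<close>, as the
      off-diagonal entry of an identity matrix must. Values at \<open>a\<close> and on
      \<open>K\<close> are unchanged, since \<open>p\<close> vanishes there.\<close>
    define x where "x = z - (z \<bullet> u) *\<^sub>R p"
    have xu: "x \<bullet> u = 0" using p(2) by (simp add: x_def inner_diff_left)
    have xa: "x \<bullet> a \<noteq> 0" using za pa by (simp add: x_def inner_diff_left)
    have pq0: "p \<bullet> y = 0 \<and> q \<bullet> y = 0" if "y \<in> S1 r M" "(p + q) \<bullet> y = 0" for y
      using p(1)[OF that(1)] q(1)[OF that(1)] that(2) by (simp add: inner_add_left)
    have xK: "x \<bullet> y = 0" if "y \<in> S1 r M" "(p + q) \<bullet> y = 0" for y
      using zK[of y] pq0[OF that] that(1) by (simp add: K_def x_def inner_diff_left)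
    have "\<exists>c\<ge>0. \<forall>y\<in>S1 r M. \<bar>x \<bullet> y\<bar> \<le> c * ((p + q) \<bullet> y)"
      by (rule polyhedral_cone_dominated_functional[OF cone]) (auto intro: xK simp: inner_add_left p(1) q(1))
    then obtain c1 where c1: "c1 \<ge> 0" "\<And>y. y \<in> S1 r M \<Longrightarrow> \<bar>x \<bullet> y\<bar> \<le> c1 * ((p + q) \<bullet> y)" by blast
    obtain \<sigma>0 where \<sigma>0: "\<And>y. y \<in> S1 r M \<Longrightarrow> 0 \<le> \<sigma>0 \<bullet> y" "\<And>y. y \<in> S1 r M \<Longrightarrow> \<sigma>0 \<bullet> y = 0 \<Longrightarrow> y = 0"
      by (rule polyhedral_cone_positive_functional[OF cone], rule that)
    have \<sigma>0u: "0 < \<sigma>0 \<bullet> u" using \<sigma>0[OF u(2)] u(1) by force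
    define \<sigma> where "\<sigma> = (1 / (\<sigma>0 \<bullet> u)) *\<^sub>R \<sigma>0"
    have \<sigma>u: "\<sigma> \<bullet> u = 1" using \<sigma>0u by (simp add: \<sigma>_def)
    have \<sigma>: "0 \<le> \<sigma> \<bullet> y" if "y \<in> S1 r M" for y
      using \<sigma>0(1)[OF that] \<sigma>0u by (simp add: \<sigma>_def)
    have \<sigma>z: "y = 0" if "y \<in> S1 r M" "\<sigma> \<bullet> y = 0" for y
      using \<sigma>0(2)[OF that(1)] that(2) \<sigma>0u by (simp add: \<sigma>_def)
    have "\<exists>c\<ge>0. \<forall>y\<in>S1 r M. \<bar>x \<bullet> y\<bar> \<le> c * (\<sigma> \<bullet> y)"
      by (rule polyhedral_cone_dominated_functional[OF cone]) (auto simp: \<sigma> dest: \<sigma>z)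
    then obtain c2 where c2: "c2 \<ge> 0" "\<And>y. y \<in> S1 r M \<Longrightarrow> \<bar>x \<bullet> y\<bar> \<le> c2 * (\<sigma> \<bullet> y)" by blast
    \<comment> \<open>One factor of \<open>(x \<bullet> y)\<^sup>2\<close> is estimated by
      \<open>p + q\<close>, the other by \<open>\<sigma>\<close>.\<close>
    define c where "c = c1 * c2"
    have c: "0 \<le> c" using c1 c2 by (simp add: c_def)
    have xsq: "(x \<bullet> y)\<^sup>2 \<le> c * (\<sigma> \<bullet> y) * (p \<bullet> y + q \<bullet> y)" if y: "y \<in> S1 r M" for y
    proof -
      have "(x \<bullet> y)\<^sup>2 = \<bar>x \<bullet> y\<bar> * \<bar>x \<bullet> y\<bar>" by (simp add: power2_eq_square)
      also have "\<dots> \<le> (c1 * ((p + q) \<bullet> y)) * (c2 * (\<sigma> \<bullet> y))"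
        using c1 c2 y p(1)[OF y] q(1)[OF y] by (intro mult_mono) (auto simp: inner_add_left)
      finally show ?thesis by (simp add: c_def inner_add_left mult_ac)
    qed
    have face: "convex_cone (S1 r M \<inter> {y. f \<bullet> y = 0})" for f
      using cone(1) by (auto simp: polyhedral_cone_def convex_cone_iff inner_simps)
    obtain h k where h: "h \<in> S1 r M" "p \<bullet> h = 0" and k: "k \<in> S1 r M" "q \<bullet> k = 0"
      and bound: "\<And>v w. cmod (sesq r (pencil M a) v w) \<le> Re (sesq r (pencil M h) v v) + Re (sesq r (pencil M k) w w)"
      using offdiag_sesq_le[OF her face[of p] Int_lower1 _ face[of q] Int_lower1] a by blast
    define L where "L = c * (\<sigma> \<bullet> h + \<sigma> \<bullet> k)"
    have L: "0 \<le> L" using c \<sigma> h k by (simp add: L_def)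
    \<comment> \<open>Compare the off-diagonal entry, of order \<open>\<epsilon>\<close>, with diagonal entries of order \<open>\<epsilon>\<^sup>2\<close>.\<close>
    have small: "\<bar>x \<bullet> a\<bar> \<le> \<epsilon> * L" if \<epsilon>: "0 < \<epsilon>" for \<epsilon>
    proof -
      \<comment> \<open>This is the common value at \<open>u\<close> of the perturbed diagonal
        functionals; dividing by it restores the value 1.\<close>
      define D where "D = 1 + \<epsilon>\<^sup>2 * c"
      have D: "0 < D" using c by (simp add: D_def add_pos_nonneg)
      define P where "P f = (1 / D) *\<^sub>R (f + (\<epsilon>\<^sup>2 * c) *\<^sub>R \<sigma>)" for f
      have P: "P f \<bullet> y = (f \<bullet> y + \<epsilon>\<^sup>2 * (c * (\<sigma> \<bullet> y))) / D" for f y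
        by (simp add: P_def inner_simps)
      have "\<bar>((\<epsilon> / D) *\<^sub>R x) \<bullet> a\<bar> \<le> P p \<bullet> h + P q \<bullet> k"
      proof (rule offdiag_compression_le[OF her compress])
        show "P p \<bullet> u = 1" "P q \<bullet> u = 1"
          unfolding P using D p(2) q(2) \<sigma>u by (simp_all add: D_def)
        show "0 \<le> P p \<bullet> y" "0 \<le> P q \<bullet> y" if "y \<in> S1 r M" for y
          unfolding P using D c p(1)[OF that] q(1)[OF that] \<sigma>[OF that] by simp_all
        show "(((\<epsilon> / D) *\<^sub>R x) \<bullet> y)\<^sup>2 \<le> (P p \<bullet> y) * (P q \<bullet> y)" if y: "y \<in> S1 r M" for y
        proof -
          have "\<epsilon>\<^sup>2 * (x \<bullet> y)\<^sup>2 \<le> \<epsilon>\<^sup>2 * (c * (\<sigma> \<bullet> y) * (p \<bullet> y + q \<bullet> y))"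
            using xsq[OF y] by (intro mult_left_mono) auto
          \<comment> \<open>The left-hand side consists of the mixed terms of the product; the two
            remaining terms are nonnegative.\<close>
          also have "\<dots> \<le> (p \<bullet> y + \<epsilon>\<^sup>2 * (c * (\<sigma> \<bullet> y))) * (q \<bullet> y + \<epsilon>\<^sup>2 * (c * (\<sigma> \<bullet> y)))"
          proof -
            have "0 \<le> (p \<bullet> y) * (q \<bullet> y)" using p(1)[OF y] q(1)[OF y] by simp
            moreover have "0 \<le> (\<epsilon>\<^sup>2 * (c * (\<sigma> \<bullet> y))) * (\<epsilon>\<^sup>2 * (c * (\<sigma> \<bullet> y)))" by simp
            ultimately show ?thesis by (simp add: algebra_simps)
          qed
          finally have "\<epsilon>\<^sup>2 * (x \<bullet> y)\<^sup>2 / (D * D)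
              \<le> (p \<bullet> y + \<epsilon>\<^sup>2 * (c * (\<sigma> \<bullet> y))) * (q \<bullet> y + \<epsilon>\<^sup>2 * (c * (\<sigma> \<bullet> y))) / (D * D)"
            using D by (intro divide_right_mono) auto
          then show ?thesis by (simp add: P power2_eq_square mult_ac)
        qed
      qed (use xu bound in simp_all)
      then have "\<epsilon> * \<bar>x \<bullet> a\<bar> / D \<le> \<epsilon>\<^sup>2 * L / D"
        unfolding P using h(2) k(2) \<epsilon> D by (simp add: L_def abs_mult algebra_simps add_divide_distrib)
      then show ?thesis using D \<epsilon> by (simp add: divide_le_cancel power2_eq_square)
    qed
    \<comment> \<open>With this \<open>\<epsilon>\<close> the bound has a factor
      \<open>L / (L + 1) < 1\<close>, contradicting \<open>x \<bullet> a \<noteq> 0\<close>.\<close>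
    have "\<bar>x \<bullet> a\<bar> \<le> \<bar>x \<bullet> a\<bar> / (L + 1) * L"
      using xa L by (intro small) simp
    then show False using xa L by (simp add: field_simps)
  qed
qed

text \<open>Pencils of size 2 suffice. Dividing \<open>p\<close> and \<open>q\<close> by their
  values at \<open>u\<close> gives the normalization of \<open>face_spans_meet\<close> and leaves
  their zero sets unchanged.\<close>

lemma simplex_cone_if_compressions:
  fixes M :: "'d::finite \<Rightarrow> complex mat"
  assumes her: "\<forall>k. M k \<in> Her r" and unit: "mat_lincomb r u M = 1\<^sub>m r"
    and cone: "polyhedral_cone (S1 r M)" "salient (S1 r M)"
    and compress: "\<And>N :: 'd \<Rightarrow> complex mat. \<forall>i. N i \<in> Her 2 \<Longrightarrow> mat_lincomb 2 u N = 1\<^sub>m 2 \<Longrightarrow> S1 r M \<subseteq> S1 2 N \<Longrightarrow>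
      \<exists>(k::nat) V. (\<forall>j<k. V j \<in> carrier_mat r 2) \<and>
        (\<forall>i. mat_sum 2 2 (\<lambda>j. mat_adjoint (V j) * M i * V j) {..<k} = N i)"
  shows "simplex_cone (S1 r M)"
proof (rule simplex_cone_if_face_spans_meet[OF cone])
  show "\<exists>\<tau>>0. u + \<tau> *\<^sub>R a \<in> S1 r M" for a
    using S1_absorbing[OF her, of 1 u] by (simp add: sesq_pencil_unit[OF her unit])
  fix p q
  assume p: "\<And>y. y \<in> S1 r M \<Longrightarrow> 0 \<le> p \<bullet> y" and q: "\<And>y. y \<in> S1 r M \<Longrightarrow> 0 \<le> q \<bullet> y"
    and pu: "0 < p \<bullet> u" and qu: "0 < q \<bullet> u"
  have "u \<noteq> 0" using pu by auto
  moreover have "u \<in> S1 r M"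
    by (simp add: S1_iff[OF her] sesq_pencil_unit[OF her unit] sqnorm_nonneg less_eq_complex_def)
  ultimately have "span (S1 r M \<inter> {y. ((1 / (p \<bullet> u)) *\<^sub>R p) \<bullet> y = 0}) \<inter> span (S1 r M \<inter> {y. ((1 / (q \<bullet> u)) *\<^sub>R q) \<bullet> y = 0})
    \<subseteq> span (S1 r M \<inter> {y. ((1 / (p \<bullet> u)) *\<^sub>R p) \<bullet> y = 0 \<and> ((1 / (q \<bullet> u)) *\<^sub>R q) \<bullet> y = 0})"
    using p q pu qu by (intro face_spans_meet[OF her cone compress]) auto
  then show "span (S1 r M \<inter> {y. p \<bullet> y = 0}) \<inter> span (S1 r M \<inter> {y. q \<bullet> y = 0})
    \<subseteq> span (S1 r M \<inter> {y. p \<bullet> y = 0 \<and> q \<bullet> y = 0})"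
    using pu qu by simp
qed

section \<open>From a simplex cone to compressions\<close>

lemma simplex_rank_one_coordinate:
  fixes M :: "'d::finite \<Rightarrow> complex mat"
  assumes her: "\<forall>k. M k \<in> Her r" and unit: "mat_lincomb r u M = 1\<^sub>m r"
    and B: "independent B" "span B = UNIV" "S1 r M = convex_cone hull B" "b \<in> B"
  shows "\<exists>v. \<forall>a. sesq r (pencil M a) v v = complex_of_real (representation B a b)"
proof -
  have fin: "finite B" using independent_imp_finite[OF B(1)] .
  have rep: "representation B (x + y) b = representation B x b + representation B y b"
    "representation B (c *\<^sub>R x) b = c * representation B x b" for x y c
    using B(1,2) by (simp_all add: representation_add representation_scale)
  have rep_basis: "representation B b' b = (if b = b' then 1 else 0)" if "b' \<in> B" for b'
    using representation_basis[OF B(1) that] by simp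
  have nonneg: "0 \<le> representation B y b" if "y \<in> S1 r M" for y
  proof -
    have "convex_cone hull B \<subseteq> {y. 0 \<le> representation B y b}"
    proof (rule hull_minimal)
      show "convex_cone {y. 0 \<le> representation B y b}"
        by (auto simp: convex_cone_iff rep representation_zero)
    qed (auto simp: rep_basis)
    then show ?thesis using that B(3) by blast
  qed
  have BS: "B \<subseteq> S1 r M" unfolding B(3) by (rule hull_subset)
  \<comment> \<open>This point is in the relative interior of the facet opposite \<open>b\<close>.
    If \<open>M(x)\<close> were definite, a short move along \<open>- b\<close> would stay in the
    cone, yet make the \<open>b\<close>-coordinate negative.\<close>
  define x where "x = \<Sum>(B - {b})"
  have "x = (\<Sum>b'\<in>B - {b}. 1 *\<^sub>R b')" by (simp add: x_def)
  also have "\<dots> \<in> convex_cone hull B"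
    by (intro convex_cone_sum[OF convex_cone_convex_cone_hull]) (auto intro: hull_inc)
  finally have "x \<in> S1 r M" using B(3) by simp
  then have x_psd: "0 \<le> sesq r (pencil M x) v v" for v by (simp add: S1_iff[OF her])
  have "representation B x b = (\<Sum>b'\<in>B - {b}. representation B b' b)"
    unfolding x_def using B(1,2) by (simp add: representation_sum)
  also have "\<dots> = 0" by (intro sum.neutral) (auto simp: rep_basis)
  finally have x_rep: "representation B x b = 0" .
  have "\<not> (\<exists>\<kappa>>0. \<forall>v. sqnorm r v \<le> \<kappa> * Re (sesq r (pencil M x) v v))"
  proof
    assume "\<exists>\<kappa>>0. \<forall>v. sqnorm r v \<le> \<kappa> * Re (sesq r (pencil M x) v v)"
    then obtain \<tau> where \<tau>: "\<tau> > 0" "x + \<tau> *\<^sub>R (- b) \<in> S1 r M"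
      using S1_absorbing[OF her] by blast
    have "representation B (x + (- \<tau>) *\<^sub>R b) b = - \<tau>"
      unfolding rep x_rep by (simp add: rep_basis[OF B(4)])
    then have "representation B (x + \<tau> *\<^sub>R (- b)) b = - \<tau>" by simp
    then show False using nonneg[OF \<tau>(2)] \<tau>(1) by simp
  qed
  then obtain v where v: "0 < sqnorm r v" "sesq r (pencil M x) v v = 0"
    using psd_singular_or_definite[OF herm_pencil[OF her] x_psd] by blast
  define f where "f a = sesq r (pencil M a) v v" for a
  have lin: "linear f" unfolding f_def by (rule linear_sesq_pencil)
  have f_nonneg: "0 \<le> f b'" if "b' \<in> B" for b'
    using that BS S1_iff[OF her] by (auto simp: f_def)
  have "(\<Sum>b'\<in>B - {b}. f b') = 0"
    using v(2) linear_sum[OF lin, of "\<lambda>b'. b'" "B - {b}"] by (simp add: f_def x_def)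
  \<comment> \<open>The values \<open>f b'\<close> are nonnegative and sum to
    \<open>f x = 0\<close>. So \<open>f\<close> depends on the \<open>b\<close>-coordinate
    only.\<close>
  then have f0: "f b' = 0" if "b' \<in> B - {b}" for b'
    using sum_nonneg_eq_0_iff[of "B - {b}" f] fin f_nonneg that by auto
  have f: "f a = complex_of_real (representation B a b) * f b" for a
  proof -
    have "a = (\<Sum>b'\<in>B. representation B a b' *\<^sub>R b')"
      using sum_representation_eq[OF B(1) _ fin] B(2) by simp
    then have "f a = f (\<Sum>b'\<in>B. representation B a b' *\<^sub>R b')" by simp
    also have "\<dots> = (\<Sum>b'\<in>B. representation B a b' *\<^sub>R f b')"
      by (simp add: linear_sum[OF lin] linear_scale[OF lin])
    also have "\<dots> = (\<Sum>b'\<in>B. if b' = b then representation B a b *\<^sub>R f b else 0)"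
      using f0 by (intro sum.cong) auto
    finally show ?thesis using fin B(4) by (simp add: scaleR_conv_of_real)
  qed
  \<comment> \<open>Normalization at \<open>u\<close> excludes \<open>f = 0\<close>, so
    \<open>f b\<close> is positive and rescaling \<open>v\<close> makes it 1.\<close>
  have "f u = complex_of_real (sqnorm r v)"
    by (simp add: f_def sesq_pencil_unit[OF her unit])
  then have "f b \<noteq> 0" using f[of u] v(1) by auto
  define s where "s = Re (f b)"
  have fb: "f b = complex_of_real s"
    using f_nonneg[OF B(4)] by (simp add: s_def less_eq_complex_def complex_eq_iff)
  have s: "0 < s" using f_nonneg[OF B(4)] \<open>f b \<noteq> 0\<close> fb by (simp add: less_eq_complex_def)
  define c where "c = complex_of_real (1 / sqrt s)"
  have c: "cnj c * c * complex_of_real s = 1"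
    using s by (simp add: c_def flip: of_real_mult)
  have "sesq r (pencil M a) (\<lambda>i. c * v i) (\<lambda>i. c * v i) = complex_of_real (representation B a b)" for a
  proof -
    have "sesq r (pencil M a) (\<lambda>i. c * v i) (\<lambda>i. c * v i) = cnj c * c * f a"
      by (simp add: f_def sesq_def sum_distrib_left mult_ac)
    also have "\<dots> = (cnj c * c * complex_of_real s) * complex_of_real (representation B a b)"
      unfolding f[of a] fb by (simp add: mult_ac)
    finally show ?thesis unfolding c by simp
  qed
  then show ?thesis by blast
qed

text \<open>Compressing \<open>M(a)\<close> by \<open>v w^*\<close> yields the
  \<open>b\<close>-coordinate of \<open>a\<close> times \<open>w w^*\<close>. Summing over the Gram
  vectors of \<open>N(b)\<close> and then over \<open>b\<close> reassembles \<open>N(a)\<close>, by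
  linearity of the pencil.\<close>

lemma compressions_if_simplex_cone:
  fixes M N :: "'d::finite \<Rightarrow> complex mat"
  assumes her: "\<forall>k. M k \<in> Her r" and unit: "mat_lincomb r u M = 1\<^sub>m r"
    and simplex: "simplex_cone (S1 r M)"
    and N: "\<forall>k. N k \<in> Her t" and sub: "S1 r M \<subseteq> S1 t N"
  shows "\<exists>(k::nat) V. (\<forall>j<k. V j \<in> carrier_mat r t) \<and>
    (\<forall>i. mat_sum t t (\<lambda>j. mat_adjoint (V j) * M i * V j) {..<k} = N i)"
proof -
  obtain B where B: "independent B" "card B = DIM(real ^ 'd)" "S1 r M = convex_cone hull B"
    using simplex unfolding simplex_cone_def by blast
  have span: "span B = UNIV"
    using card_ge_dim_independent[of B UNIV] B(1,2) by (auto simp: dim_UNIV)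
  have fin: "finite B" using independent_imp_finite[OF B(1)] .
  obtain v where v: "\<And>b a. b \<in> B \<Longrightarrow> sesq r (pencil M a) (v b) (v b) = complex_of_real (representation B a b)"
    using simplex_rank_one_coordinate[OF her unit B(1) span B(3)] by metis
  have "\<exists>w. \<forall>p<t. \<forall>q<t. pencil N b p q = (\<Sum>l<t. w l p * cnj (w l q))" if "b \<in> B" for b
  proof (rule psd_gram[OF herm_pencil[OF N]])
    have "b \<in> S1 t N" using that sub B(3) hull_subset[of B convex_cone] by blast
    then show "0 \<le> sesq t (pencil N b) x x" for x by (simp add: S1_iff[OF N])
  qed
  then obtain w where w: "\<And>b p q. b \<in> B \<Longrightarrow> p < t \<Longrightarrow> q < t \<Longrightarrow>
      pencil N b p q = (\<Sum>l<t. w b l p * cnj (w b l q))"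
    by metis
  define k where "k = card (B \<times> {..<t})"
  \<comment> \<open>The matrices are naturally indexed by a generator and a Gram vector;
    \<open>e\<close> lists these pairs by numbers below \<open>k\<close>.\<close>
  obtain e where e: "bij_betw e {..<k} (B \<times> {..<t})"
    using ex_bij_betw_nat_finite[of "B \<times> {..<t}"] fin unfolding k_def atLeast0LessThan by blast
  define W where "W bl = mat r t (\<lambda>(i, q). v (fst bl) i * cnj (w (fst bl) (snd bl) q))" for bl
  have W: "W bl \<in> carrier_mat r t" for bl by (simp add: W_def)
  have "mat_sum t t (\<lambda>j. mat_adjoint (W (e j)) * M i * W (e j)) {..<k} = N i" for i
  proof (rule eq_matI)
    have M: "M i \<in> carrier_mat r r" and Ni: "N i \<in> carrier_mat t t"
      using her N by (simp_all add: Her_def)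
    show "dim_row (mat_sum t t (\<lambda>j. mat_adjoint (W (e j)) * M i * W (e j)) {..<k}) = dim_row (N i)"
      "dim_col (mat_sum t t (\<lambda>j. mat_adjoint (W (e j)) * M i * W (e j)) {..<k}) = dim_col (N i)"
      using Ni by (simp_all add: mat_sum_def)
    fix p q assume "p < dim_row (N i)" "q < dim_col (N i)"
    then have pq: "p < t" "q < t" using Ni by simp_all
    \<comment> \<open>At a unit vector the pencils return the single matrices \<open>M i\<close> and
      \<open>N i\<close>.\<close>
    define a :: "real ^ 'd" where "a = axis i 1"
    have entry: "(mat_adjoint (W (b, l)) * M i * W (b, l)) $$ (p, q)
        = complex_of_real (representation B a b) * (w b l p * cnj (w b l q))" if b: "b \<in> B" for b l
    proof -
      have "(mat_adjoint (W (b, l)) * M i * W (b, l)) $$ (p, q)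
          = sesq r (pencil M a) (\<lambda>x. W (b, l) $$ (x, p)) (\<lambda>x. W (b, l) $$ (x, q))"
        unfolding adjoint_mult_index[OF W M pq] a_def by (simp add: pencil_axis sesq_def)
      also have "\<dots> = (w b l p * cnj (w b l q)) * sesq r (pencil M a) (v b) (v b)"
        using pq by (simp add: sesq_def W_def sum_distrib_left mult_ac)
      finally show ?thesis using v[OF b] by (simp add: mult_ac)
    qed
    have "mat_sum t t (\<lambda>j. mat_adjoint (W (e j)) * M i * W (e j)) {..<k} $$ (p, q)
        = (\<Sum>j<k. (mat_adjoint (W (e j)) * M i * W (e j)) $$ (p, q))"
      using pq by (simp add: mat_sum_def)
    also have "\<dots> = (\<Sum>bl\<in>B \<times> {..<t}. (mat_adjoint (W bl) * M i * W bl) $$ (p, q))"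
      by (rule sum.reindex_bij_betw[OF e])
    also have "\<dots> = (\<Sum>b\<in>B. \<Sum>l<t. (mat_adjoint (W (b, l)) * M i * W (b, l)) $$ (p, q))"
      by (simp add: sum.cartesian_product split_def)
    also have "\<dots> = (\<Sum>b\<in>B. representation B a b *\<^sub>R pencil N b p q)"
      using pq by (intro sum.cong refl) (simp add: entry w sum_distrib_left scaleR_conv_of_real)
    also have "\<dots> = pencil N (\<Sum>b\<in>B. representation B a b *\<^sub>R b) p q"
      by (simp add: linear_sum[OF linear_pencil] linear_scale[OF linear_pencil])
    also have "(\<Sum>b\<in>B. representation B a b *\<^sub>R b) = a"
      using sum_representation_eq[OF B(1) _ fin] span by simp
    finally show "mat_sum t t (\<lambda>j. mat_adjoint (W (e j)) * M i * W (e j)) {..<k} $$ (p, q) = N i $$ (p, q)"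
      by (simp add: a_def pencil_axis)
  qed
  then show ?thesis using W by (intro exI[of _ k] exI[of _ "\<lambda>j. W (e j)"]) blast
qed

theorem corollary5p3:
  fixes u :: "real ^ 'd::finite" and r :: nat and M :: "'d \<Rightarrow> complex mat"
  assumes "\<And>i. M i \<in> Her r"
    and "mat_lincomb r u M = 1\<^sub>m r"
    and "polyhedral_cone (S1 r M)"
    and "salient (S1 r M)"
  shows
    "(\<forall>t\<ge>1. \<forall>N :: 'd \<Rightarrow> complex mat.
        (\<forall>i. N i \<in> Her t) \<longrightarrow> mat_lincomb t u N = 1\<^sub>m t \<longrightarrow> S1 r M \<subseteq> S1 t N \<longrightarrow>
        (\<exists>(k::nat) V. (\<forall>j<k. V j \<in> carrier_mat r t) \<and>
          (\<forall>i. mat_sum t t (\<lambda>j. mat_adjoint (V j) * M i * V j) {..<k} = N i)))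
     \<longleftrightarrow> simplex_cone (S1 r M)"
proof
  assume *: "\<forall>t\<ge>1. \<forall>N :: 'd \<Rightarrow> complex mat.
        (\<forall>i. N i \<in> Her t) \<longrightarrow> mat_lincomb t u N = 1\<^sub>m t \<longrightarrow> S1 r M \<subseteq> S1 t N \<longrightarrow>
        (\<exists>(k::nat) V. (\<forall>j<k. V j \<in> carrier_mat r t) \<and>
          (\<forall>i. mat_sum t t (\<lambda>j. mat_adjoint (V j) * M i * V j) {..<k} = N i))"
  show "simplex_cone (S1 r M)"
    by (rule simplex_cone_if_compressions[OF _ assms(2-4)]) (use assms(1) *[rule_format, of 2] in simp_all)
next
  assume "simplex_cone (S1 r M)"
  then show "\<forall>t\<ge>1. \<forall>N :: 'd \<Rightarrow> complex mat.
        (\<forall>i. N i \<in> Her t) \<longrightarrow> mat_lincomb t u N = 1\<^sub>m t \<longrightarrow> S1 r M \<subseteq> S1 t N \<longrightarrow>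
        (\<exists>(k::nat) V. (\<forall>j<k. V j \<in> carrier_mat r t) \<and>
          (\<forall>i. mat_sum t t (\<lambda>j. mat_adjoint (V j) * M i * V j) {..<k} = N i))"
    using compressions_if_simplex_cone[OF _ assms(2)] assms(1) by blast
qed

end
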